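(* Let $\mathcal{A}=(\mathcal{A}_L,\mathcal{A}_R,S)$ be a Hopf algebroid over a commutative ring $k$, with $\mathcal{A}_L=(A,L,s_L,t_L,\gamma_L,\pi_L)$ and $\mathcal{A}_R=(A,R,s_R,t_R,\gamma_R,\pi_R)$, such that all of the modules $A^R$, ${}^RA$, ${}_LA$ and $A_L$ are finitely generated and projective. Then there exist non-zero elements in all of $\mathcal{L}(\mathcal{A}^* )$, $\mathcal{L}({}^*\mathcal{A})$, $\mathcal{R}({}_*\mathcal{A})$ and $\mathcal{R}(\mathcal{A}_* )$.
   Context: Algebras are associative unital algebras over a commutative ring $k$. **Left bialgebroid.** A left bialgebroid $(A,L,s,t,\gamma,\pi)$ consists of $k$-algebras $A$ (total) and $L$ (base), algebra homomorphisms $s:L\to A$ and $t:L^{op}\to A$ with commuting ranges, and an $L$-coring structure (coassociative coproduct $\gamma:A\to A\otimes_L A$ and counit $\pi:A\to L$, both $L$-$L$ bimodule maps) on the $L$-$L$ bimodule $A$ with actions $l\cdot a\cdot l'=s(l)t(l')a$. Writing $\gamma(a)=a_{(1)}\otimes a_{(2)}$, it is required that $a_{(1)}t(l)\otimes a_{(2)}=a_{(1)}\otimes a_{(2)}s(l)$, $\gamma(1)=1\otimes 1$, $\gamma(aa')=\gamma(a)\gamma(a')$, $\pi(1)=1$, $\pi(a\,s(\pi(a')))=\pi(aa')=\pi(a\,t(\pi(a')))$. **Right bialgebroid.** $(A,R,s,t,\gamma,\pi)$ is a right bialgebroid if $(A^{op},R,t,s,\gamma,\pi)$ is a left bialgebroid.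 Explicitly: $s:R\to A$, $t:R^{op}\to A$ are algebra maps with commuting ranges; $(A,\gamma,\pi)$ is an $R$-coring for the bimodule $r\cdot a\cdot r'=a\,s(r')t(r)$; and, with $\gamma(a)=a^{(1)}\otimes a^{(2)}$: $s(r)a^{(1)}\otimes a^{(2)}=a^{(1)}\otimes t(r)a^{(2)}$, $\gamma(1)=1\otimes1$, $\gamma(aa')=\gamma(a)\gamma(a')$, $\pi(1)=1$, $\pi(s(\pi(a))a')=\pi(aa')=\pi(t(\pi(a))a')$. **Module notation.** For $B\in\{L,R\}$ with $s=s_B,t=t_B$: ${}_BA$ is $A$ with left action $b\cdot a=s(b)a$; $A_B$ has right action $a\cdot b=t(b)a$; $A^B$ has right action $a\cdot b=a\,s(b)$; ${}^BA$ has left action $b\cdot a=a\,t(b)$. In a tensor product the displayed module structures are the ones balanced over $B$, e.g. $A_L\otimes{}_LA$ has $t_L(l)a\otimes b=a\otimes s_L(l)b$, $A^R\otimes{}^RA$ has $as_R(r)\otimes b=a\otimes bt_R(r)$. **Hopf algebroid.** $\mathcal{A}=(\mathcal{A}_L,\mathcal{A}_R,S)$ consists of a left bialgebroid $\mathcal{A}_L=(A,L,s_L,t_L,\gamma_L,\pi_L)$ and a right bialgebroid $\mathcal{A}_R=(A,R,s_R,t_R,\gamma_R,\pi_R)$ on the same total algebra $A$ and a $k$-linear map $S:A\to A$ (antipode, not assumed bijective) such that (i) $s_L\pi_Lt_R=t_R$, $t_L\pi_Ls_R=s_R$, $s_R\pi_Rt_L=t_L$, $t_R\pi_Rs_L=s_L$;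 (ii) $(\gamma_L\otimes{}^RA)\gamma_R=(A_L\otimes\gamma_R)\gamma_L$ as maps $A\to A_L\otimes{}_LA^R\otimes{}^RA$, and $(\gamma_R\otimes{}_LA)\gamma_L=(A^R\otimes\gamma_L)\gamma_R$ as maps $A\to A^R\otimes{}^RA_L\otimes{}_LA$; (iii) $S(t_L(l')\,a\,t_L(l))=s_L(l)S(a)s_L(l')$ and $S(t_R(r')\,a\,t_R(r))=s_R(r)S(a)s_R(r')$; (iv) $S(a_{(1)})a_{(2)}=s_R\pi_R(a)$ and $a^{(1)}S(a^{(2)})=s_L\pi_L(a)$, where $\gamma_L(a)=a_{(1)}\otimes a_{(2)}$ and $\gamma_R(a)=a^{(1)}\otimes a^{(2)}$. **Duals and integrals on $\mathcal{A}$.** ${}_*\mathcal{A}={}_L\mathrm{Hom}({}_LA,L)$, $\mathcal{A}_*=\mathrm{Hom}_L(A_L,L)$, $\mathcal{A}^*=\mathrm{Hom}_R(A^R,R)$, ${}^*\mathcal{A}={}_R\mathrm{Hom}({}^RA,R)$; $\mathcal{R}({}_*\mathcal{A})=\{{}_*\rho\in{}_*\mathcal{A}\mid t_L({}_*\rho(a_{(2)}))a_{(1)}=s_L({}_*\rho(a))\ \forall a\in A\}$; $\mathcal{R}(\mathcal{A}_* )=\{\rho_*\in\mathcal{A}_*\mid s_L(\rho_*(a_{(1)}))a_{(2)}=t_L(\rho_*(a))\ \forall a\in A\}$; $\mathcal{L}(\mathcal{A}^* )=\{\lambda^*\in\mathcal{A}^*\mid a^{(2)}t_R(\lambda^*(a^{(1)}))=s_R(\lambda^*(a))\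 \forall a\in A\}$; $\mathcal{L}({}^*\mathcal{A})=\{{}^*\lambda\in{}^*\mathcal{A}\mid a^{(1)}s_R({}^*\lambda(a^{(2)}))=t_R({}^*\lambda(a))\ \forall a\in A\}$. *)

theory Defs
  imports Complex_Main "HOL-Library.Poly_Mapping" "HOL-Computational_Algebra.Group_Closure"
begin

section \<open>Algebras\<close>

text \<open>Associative unital algebras over a commutative ring. The class \<open>ring_1\<close> includes \<open>0 \<noteq> 1\<close>, so
  all rings below are nonzero; over the zero algebra every dual is zero, so no nonzero integral can
  exist.\<close>

locale k_algebra = module scale
  for scale :: "'k::comm_ring_1 \<Rightarrow> 'a::ring_1 \<Rightarrow> 'a" +
  assumes scale_mult_left: "scale c (x * y) = scale c x * y"
    and scale_mult_right: "scale c (x * y) = x * scale c y"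

locale k_algebra_hom =
  dom: k_algebra scale1 + cod: k_algebra scale2 + module_hom scale1 scale2 f
  for scale1 :: "'k::comm_ring_1 \<Rightarrow> 'a::ring_1 \<Rightarrow> 'a"
    and scale2 :: "'k \<Rightarrow> 'b::ring_1 \<Rightarrow> 'b"
    and f :: "'a \<Rightarrow> 'b" +
  assumes map_one: "f 1 = 1"
    and map_mult: "f (x * y) = f x * f y"

text \<open>An algebra homomorphism \<open>L\<^sup>o\<^sup>p \<rightarrow> A\<close>, as a map on \<open>L\<close>.\<close>

locale k_algebra_antihom =
  dom: k_algebra scale1 + cod: k_algebra scale2 + module_hom scale1 scale2 f
  for scale1 :: "'k::comm_ring_1 \<Rightarrow> 'a::ring_1 \<Rightarrow> 'a"
    and scale2 :: "'k \<Rightarrow> 'b::ring_1 \<Rightarrow> 'b"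
    and f :: "'a \<Rightarrow> 'b" +
  assumes map_one: "f 1 = 1"
    and map_mult: "f (x * y) = f y * f x"


section \<open>Modules over possibly noncommutative rings\<close>

text \<open>A left module over \<open>'r\<close> is given by its action \<open>'r \<Rightarrow> 'm \<Rightarrow> 'm\<close>, a right module by its action
  \<open>'m \<Rightarrow> 'r \<Rightarrow> 'm\<close>. The module axioms are not repeated here: for the actions used below they
  follow from those of source and target maps.\<close>

definition left_hom ::
  "('r \<Rightarrow> 'm::ab_group_add \<Rightarrow> 'm) \<Rightarrow> ('r \<Rightarrow> 'n::ab_group_add \<Rightarrow> 'n) \<Rightarrow> ('m \<Rightarrow> 'n) \<Rightarrow> bool"
  where "left_hom actM actN f \<longleftrightarrow> additive f \<and> (\<forall>r x. f (actM r x) = actN r (f x))"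

definition right_hom ::
  "('m::ab_group_add \<Rightarrow> 'r \<Rightarrow> 'm) \<Rightarrow> ('n::ab_group_add \<Rightarrow> 'r \<Rightarrow> 'n) \<Rightarrow> ('m \<Rightarrow> 'n) \<Rightarrow> bool"
  where "right_hom actM actN f \<longleftrightarrow> additive f \<and> (\<forall>x r. f (actM x r) = actN (f x) r)"

definition left_finitely_generated :: "('r \<Rightarrow> 'm::ab_group_add \<Rightarrow> 'm) \<Rightarrow> bool"
  where "left_finitely_generated actM \<longleftrightarrow> (\<exists>X. finite X \<and> (\<forall>m. \<exists>c. m = (\<Sum>x\<in>X. actM (c x) x)))"

definition right_finitely_generated :: "('m::ab_group_add \<Rightarrow> 'r \<Rightarrow> 'm) \<Rightarrow> bool"
  where "right_finitely_generated actM \<longleftrightarrow> (\<exists>X. finite X \<and> (\<forall>m. \<exists>c. m = (\<Sum>x\<in>X. actM x (c x))))"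

text \<open>A module is projective if it is a direct summand (that is, a retract) of a free module.
  Every module \<open>M\<close> is a quotient of the free module on its underlying set, so that it suffices to
  consider that free module, whose elements are the finitely supported functions
  \<open>'m \<Rightarrow>\<^sub>0 'r\<close>.\<close>

definition left_projective :: "('r::ring_1 \<Rightarrow> 'm::ab_group_add \<Rightarrow> 'm) \<Rightarrow> bool"
  where "left_projective actM \<longleftrightarrow>
    (\<exists>(i :: 'm \<Rightarrow> ('m \<Rightarrow>\<^sub>0 'r)) (p :: ('m \<Rightarrow>\<^sub>0 'r) \<Rightarrow> 'm).
      left_hom actM (\<lambda>r. Poly_Mapping.map (\<lambda>c. r * c)) i \<and>
      left_hom (\<lambda>r. Poly_Mapping.map (\<lambda>c. r * c)) actM p \<and>
      p \<circ> i = id)"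

definition right_projective :: "('m::ab_group_add \<Rightarrow> 'r::ring_1 \<Rightarrow> 'm) \<Rightarrow> bool"
  where "right_projective actM \<longleftrightarrow>
    (\<exists>(i :: 'm \<Rightarrow> ('m \<Rightarrow>\<^sub>0 'r)) (p :: ('m \<Rightarrow>\<^sub>0 'r) \<Rightarrow> 'm).
      right_hom actM (\<lambda>u r. Poly_Mapping.map (\<lambda>c. c * r) u) i \<and>
      right_hom (\<lambda>u r. Poly_Mapping.map (\<lambda>c. c * r) u) actM p \<and>
      p \<circ> i = id)"

text \<open>The four module structures on the total algebra, written \<open>\<^sub>BA\<close>, \<open>A\<^sub>B\<close>, \<open>A\<^sup>B\<close>, \<open>\<^sup>BA\<close>.\<close>

definition lower_left :: "('b \<Rightarrow> 'a::ring_1) \<Rightarrow> 'b \<Rightarrow> 'a \<Rightarrow> 'a"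
  where "lower_left s b a = s b * a"

definition lower_right :: "('b \<Rightarrow> 'a::ring_1) \<Rightarrow> 'a \<Rightarrow> 'b \<Rightarrow> 'a"
  where "lower_right t a b = t b * a"

definition upper_right :: "('b \<Rightarrow> 'a::ring_1) \<Rightarrow> 'a \<Rightarrow> 'b \<Rightarrow> 'a"
  where "upper_right s a b = a * s b"

definition upper_left :: "('b \<Rightarrow> 'a::ring_1) \<Rightarrow> 'b \<Rightarrow> 'a \<Rightarrow> 'a"
  where "upper_left t b a = a * t b"


section \<open>Tensor products\<close>

text \<open>The tensor product of a right module (action \<open>ra\<close>) and a left module (action \<open>la\<close>) is the
  free abelian group on pairs modulo the subgroup generated by \<open>balancing2 ra la\<close>; its elements are
  the equivalence classes of \<open>tensor2_rel ra la\<close>. For modules over a \<open>k\<close>-algebra the action of \<open>k\<close>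
  factors through the balanced ring, so no separate \<open>k\<close>-linearity relation is needed.\<close>

definition balancing2 ::
  "('m::ab_group_add \<Rightarrow> 'b \<Rightarrow> 'm) \<Rightarrow> ('b \<Rightarrow> 'n::ab_group_add \<Rightarrow> 'n) \<Rightarrow> ('m \<times> 'n \<Rightarrow>\<^sub>0 int) set"
  where "balancing2 ra la =
    {frag_of (x + x', y) - frag_of (x, y) - frag_of (x', y) | x x' y. True} \<union>
    {frag_of (x, y + y') - frag_of (x, y) - frag_of (x, y') | x y y'. True} \<union>
    {frag_of (ra x b, y) - frag_of (x, la b y) | x b y. True}"

definition tensor2_rel ::
  "('m::ab_group_add \<Rightarrow> 'b \<Rightarrow> 'm) \<Rightarrow> ('b \<Rightarrow> 'n::ab_group_add \<Rightarrow> 'n) \<Rightarrow> ('m \<times> 'n \<Rightarrow>\<^sub>0 int) rel"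
  where "tensor2_rel ra la = {(u, v). u - v \<in> group_closure (balancing2 ra la)}"

text \<open>The threefold tensor product, balanced between the first two factors by \<open>ra\<close>, \<open>la\<close> and
  between the last two by \<open>ra'\<close>, \<open>la'\<close>.\<close>

definition balancing3 ::
  "('m::ab_group_add \<Rightarrow> 'b \<Rightarrow> 'm) \<Rightarrow> ('b \<Rightarrow> 'n::ab_group_add \<Rightarrow> 'n) \<Rightarrow>
   ('n \<Rightarrow> 'c \<Rightarrow> 'n) \<Rightarrow> ('c \<Rightarrow> 'p::ab_group_add \<Rightarrow> 'p) \<Rightarrow> ('m \<times> 'n \<times> 'p \<Rightarrow>\<^sub>0 int) set"
  where "balancing3 ra la ra' la' =
    {frag_of (x + x', y, z) - frag_of (x, y, z) - frag_of (x', y, z) | x x' y z. True} \<union>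
    {frag_of (x, y + y', z) - frag_of (x, y, z) - frag_of (x, y', z) | x y y' z. True} \<union>
    {frag_of (x, y, z + z') - frag_of (x, y, z) - frag_of (x, y, z') | x y z z'. True} \<union>
    {frag_of (ra x b, y, z) - frag_of (x, la b y, z) | x b y z. True} \<union>
    {frag_of (x, ra' y c, z) - frag_of (x, y, la' c z) | x y c z. True}"

definition tensor3_rel ::
  "('m::ab_group_add \<Rightarrow> 'b \<Rightarrow> 'm) \<Rightarrow> ('b \<Rightarrow> 'n::ab_group_add \<Rightarrow> 'n) \<Rightarrow>
   ('n \<Rightarrow> 'c \<Rightarrow> 'n) \<Rightarrow> ('c \<Rightarrow> 'p::ab_group_add \<Rightarrow> 'p) \<Rightarrow> ('m \<times> 'n \<times> 'p \<Rightarrow>\<^sub>0 int) rel"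
  where "tensor3_rel ra la ra' la' = {(u, v). u - v \<in> group_closure (balancing3 ra la ra' la')}"

lemma equiv_tensor2_rel: "equiv UNIV (tensor2_rel ra la)"
proof (rule equivI)
  show "tensor2_rel ra la \<subseteq> UNIV \<times> UNIV" by simp
  show "refl (tensor2_rel ra la)"
    by (auto simp: refl_on_def tensor2_rel_def)
  show "sym (tensor2_rel ra la)"
    unfolding sym_def tensor2_rel_def by (metis (mono_tags) case_prodD case_prodI group_closure_minus_iff mem_Collect_eq minus_diff_eq)
  show "trans (tensor2_rel ra la)"
    unfolding trans_def tensor2_rel_def using group_closure_add by fastforce
qed

lemma equiv_tensor3_rel: "equiv UNIV (tensor3_rel ra la ra' la')"
proof (rule equivI)
  show "tensor3_rel ra la ra' la' \<subseteq> UNIV \<times> UNIV" by simp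
  show "refl (tensor3_rel ra la ra' la')"
    by (auto simp: refl_on_def tensor3_rel_def)
  show "sym (tensor3_rel ra la ra' la')"
    unfolding sym_def tensor3_rel_def by (metis (mono_tags) case_prodD case_prodI group_closure_minus_iff mem_Collect_eq minus_diff_eq)
  show "trans (tensor3_rel ra la ra' la')"
    unfolding trans_def tensor3_rel_def using group_closure_add by fastforce
qed

text \<open>Maps out of a tensor product are evaluated on a representative of the class. Wherever this is
  done below, the map is balanced by the other axioms, so the choice of representative is
  immaterial.\<close>

definition tensor_rep :: "'x set \<Rightarrow> 'x"
  where "tensor_rep X = (SOME u. u \<in> X)"

text \<open>If \<open>\<gamma> a\<close> is \<open>a\<^sub>1 \<otimes> a\<^sub>2\<close> in Sweedler notation, then \<open>sweedler f (\<gamma> a)\<close> is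
  \<open>f a\<^sub>1 a\<^sub>2\<close> (summation understood).\<close>

definition sweedler :: "('m \<Rightarrow> 'n \<Rightarrow> 'c::ring_1) \<Rightarrow> ('m \<times> 'n \<Rightarrow>\<^sub>0 int) set \<Rightarrow> 'c"
  where "sweedler f X =
    (let u = tensor_rep X in \<Sum>(x, y)\<in>Poly_Mapping.keys u. of_int (Poly_Mapping.lookup u (x, y)) * f x y)"

text \<open>\<open>f \<otimes> g\<close> and the factorwise product, on representatives.\<close>

definition tensor_map ::
  "('m \<Rightarrow> 'm') \<Rightarrow> ('n \<Rightarrow> 'n') \<Rightarrow> ('m \<times> 'n \<Rightarrow>\<^sub>0 int) \<Rightarrow> ('m' \<times> 'n' \<Rightarrow>\<^sub>0 int)"
  where "tensor_map f g = frag_extend (\<lambda>(x, y). frag_of (f x, g y))"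

definition tensor_mult ::
  "('m::times \<times> 'n::times \<Rightarrow>\<^sub>0 int) \<Rightarrow> ('m \<times> 'n \<Rightarrow>\<^sub>0 int) \<Rightarrow> ('m \<times> 'n \<Rightarrow>\<^sub>0 int)"
  where "tensor_mult u v = frag_extend (\<lambda>(x, y). tensor_map (\<lambda>x'. x * x') (\<lambda>y'. y * y') v) u"

text \<open>\<open>\<gamma> \<otimes> A\<close> and \<open>A \<otimes> \<gamma>\<close>, on representatives.\<close>

definition coproduct_left ::
  "('m \<Rightarrow> ('m' \<times> 'm'' \<Rightarrow>\<^sub>0 int) set) \<Rightarrow> ('m \<times> 'n \<Rightarrow>\<^sub>0 int) \<Rightarrow> ('m' \<times> 'm'' \<times> 'n \<Rightarrow>\<^sub>0 int)"
  where "coproduct_left \<gamma> =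
    frag_extend (\<lambda>(x, y). frag_extend (\<lambda>(x', x''). frag_of (x', x'', y)) (tensor_rep (\<gamma> x)))"

definition coproduct_right ::
  "('n \<Rightarrow> ('n' \<times> 'n'' \<Rightarrow>\<^sub>0 int) set) \<Rightarrow> ('m \<times> 'n \<Rightarrow>\<^sub>0 int) \<Rightarrow> ('m \<times> 'n' \<times> 'n'' \<Rightarrow>\<^sub>0 int)"
  where "coproduct_right \<gamma> =
    frag_extend (\<lambda>(x, y). frag_extend (\<lambda>(y', y''). frag_of (x, y', y'')) (tensor_rep (\<gamma> y)))"


section \<open>Bialgebroids\<close>

text \<open>\<open>A\<^sub>L \<otimes> \<^sub>LA\<close>, where \<open>t(l)a \<otimes> b = a \<otimes> s(l)b\<close>, and
  \<open>A\<^sup>R \<otimes> \<^sup>RA\<close>, where \<open>a s(r) \<otimes> b = a \<otimes> b t(r)\<close>.\<close>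

abbreviation lower_tensor :: "('l \<Rightarrow> 'a::ring_1) \<Rightarrow> ('l \<Rightarrow> 'a) \<Rightarrow> ('a \<times> 'a \<Rightarrow>\<^sub>0 int) rel"
  where "lower_tensor s t \<equiv> tensor2_rel (lower_right t) (lower_left s)"

abbreviation upper_tensor :: "('r \<Rightarrow> 'a::ring_1) \<Rightarrow> ('r \<Rightarrow> 'a) \<Rightarrow> ('a \<times> 'a \<Rightarrow>\<^sub>0 int) rel"
  where "upper_tensor s t \<equiv> tensor2_rel (upper_right s) (upper_left t)"

locale left_bialgebroid =
  source: k_algebra_hom scaleL scaleA s + target: k_algebra_antihom scaleL scaleA t
  for scaleA :: "'k::comm_ring_1 \<Rightarrow> 'a::ring_1 \<Rightarrow> 'a"
    and scaleL :: "'k \<Rightarrow> 'l::ring_1 \<Rightarrow> 'l"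
    and s :: "'l \<Rightarrow> 'a"
    and t :: "'l \<Rightarrow> 'a" +
  fixes \<gamma> :: "'a \<Rightarrow> ('a \<times> 'a \<Rightarrow>\<^sub>0 int) set"
    and \<pi> :: "'a \<Rightarrow> 'l"
  assumes source_target_commute: "s l * t l' = t l' * s l"
    and coproduct_in: "\<gamma> a \<in> UNIV // lower_tensor s t"
    and coproduct_add: "\<gamma> (a + a') = lower_tensor s t `` {tensor_rep (\<gamma> a) + tensor_rep (\<gamma> a')}"
    and coproduct_bimodule:
      "\<gamma> (s l * t l' * a) =
        lower_tensor s t `` {tensor_map (\<lambda>x. s l * x) (\<lambda>y. t l' * y) (tensor_rep (\<gamma> a))}"
    and counit_add: "\<pi> (a + a') = \<pi> a + \<pi> a'"
    and counit_bimodule: "\<pi> (s l * t l' * a) = l * \<pi> a * l'"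
    and coassociative:
      "(coproduct_left \<gamma> (tensor_rep (\<gamma> a)), coproduct_right \<gamma> (tensor_rep (\<gamma> a)))
        \<in> tensor3_rel (lower_right t) (lower_left s) (lower_right t) (lower_left s)"
    and counit_left: "sweedler (\<lambda>x y. s (\<pi> x) * y) (\<gamma> a) = a"
    and counit_right: "sweedler (\<lambda>x y. t (\<pi> y) * x) (\<gamma> a) = a"
    and takeuchi:
      "(tensor_map (\<lambda>x. x * t l) id (tensor_rep (\<gamma> a)),
        tensor_map id (\<lambda>y. y * s l) (tensor_rep (\<gamma> a))) \<in> lower_tensor s t"
    and coproduct_one: "\<gamma> 1 = lower_tensor s t `` {frag_of (1, 1)}"
    and coproduct_mult:
      "\<gamma> (a * a') = lower_tensor s t `` {tensor_mult (tensor_rep (\<gamma> a)) (tensor_rep (\<gamma> a'))}"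
    and counit_one: "\<pi> 1 = 1"
    and counit_mult_source: "\<pi> (a * s (\<pi> a')) = \<pi> (a * a')"
    and counit_mult_target: "\<pi> (a * t (\<pi> a')) = \<pi> (a * a')"

text \<open>This is \<open>left_bialgebroid\<close> for the opposite of the total algebra, with source and target
  exchanged, spelled out because the multiplication of a type in class \<open>ring_1\<close> is fixed.\<close>

locale right_bialgebroid =
  source: k_algebra_hom scaleR scaleA s + target: k_algebra_antihom scaleR scaleA t
  for scaleA :: "'k::comm_ring_1 \<Rightarrow> 'a::ring_1 \<Rightarrow> 'a"
    and scaleR :: "'k \<Rightarrow> 'r::ring_1 \<Rightarrow> 'r"
    and s :: "'r \<Rightarrow> 'a"
    and t :: "'r \<Rightarrow> 'a" +
  fixes \<gamma> :: "'a \<Rightarrow> ('a \<times> 'a \<Rightarrow>\<^sub>0 int) set"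
    and \<pi> :: "'a \<Rightarrow> 'r"
  assumes source_target_commute: "s r * t r' = t r' * s r"
    and coproduct_in: "\<gamma> a \<in> UNIV // upper_tensor s t"
    and coproduct_add: "\<gamma> (a + a') = upper_tensor s t `` {tensor_rep (\<gamma> a) + tensor_rep (\<gamma> a')}"
    and coproduct_bimodule:
      "\<gamma> (a * s r' * t r) =
        upper_tensor s t `` {tensor_map (\<lambda>x. x * t r) (\<lambda>y. y * s r') (tensor_rep (\<gamma> a))}"
    and counit_add: "\<pi> (a + a') = \<pi> a + \<pi> a'"
    and counit_bimodule: "\<pi> (a * s r' * t r) = r * \<pi> a * r'"
    and coassociative:
      "(coproduct_left \<gamma> (tensor_rep (\<gamma> a)), coproduct_right \<gamma> (tensor_rep (\<gamma> a)))
        \<in> tensor3_rel (upper_right s) (upper_left t) (upper_right s) (upper_left t)"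
    and counit_left: "sweedler (\<lambda>x y. y * t (\<pi> x)) (\<gamma> a) = a"
    and counit_right: "sweedler (\<lambda>x y. x * s (\<pi> y)) (\<gamma> a) = a"
    and takeuchi:
      "(tensor_map (\<lambda>x. s r * x) id (tensor_rep (\<gamma> a)),
        tensor_map id (\<lambda>y. t r * y) (tensor_rep (\<gamma> a))) \<in> upper_tensor s t"
    and coproduct_one: "\<gamma> 1 = upper_tensor s t `` {frag_of (1, 1)}"
    and coproduct_mult:
      "\<gamma> (a * a') = upper_tensor s t `` {tensor_mult (tensor_rep (\<gamma> a)) (tensor_rep (\<gamma> a'))}"
    and counit_one: "\<pi> 1 = 1"
    and counit_mult_source: "\<pi> (s (\<pi> a) * a') = \<pi> (a * a')"
    and counit_mult_target: "\<pi> (t (\<pi> a) * a') = \<pi> (a * a')"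


section \<open>Hopf algebroids\<close>

locale hopf_algebroid =
  left: left_bialgebroid scaleA scaleL s\<^sub>L t\<^sub>L \<gamma>\<^sub>L \<pi>\<^sub>L +
  right: right_bialgebroid scaleA scaleR s\<^sub>R t\<^sub>R \<gamma>\<^sub>R \<pi>\<^sub>R +
  antipode: module_hom scaleA scaleA S
  for scaleA :: "'k::comm_ring_1 \<Rightarrow> 'a::ring_1 \<Rightarrow> 'a"
    and scaleL :: "'k \<Rightarrow> 'l::ring_1 \<Rightarrow> 'l"
    and scaleR :: "'k \<Rightarrow> 'r::ring_1 \<Rightarrow> 'r"
    and s\<^sub>L :: "'l \<Rightarrow> 'a"
    and t\<^sub>L :: "'l \<Rightarrow> 'a"
    and \<gamma>\<^sub>L :: "'a \<Rightarrow> ('a \<times> 'a \<Rightarrow>\<^sub>0 int) set"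
    and \<pi>\<^sub>L :: "'a \<Rightarrow> 'l"
    and s\<^sub>R :: "'r \<Rightarrow> 'a"
    and t\<^sub>R :: "'r \<Rightarrow> 'a"
    and \<gamma>\<^sub>R :: "'a \<Rightarrow> ('a \<times> 'a \<Rightarrow>\<^sub>0 int) set"
    and \<pi>\<^sub>R :: "'a \<Rightarrow> 'r"
    and S :: "'a \<Rightarrow> 'a" +
  assumes sL_piL_tR: "s\<^sub>L (\<pi>\<^sub>L (t\<^sub>R r)) = t\<^sub>R r"
    and tL_piL_sR: "t\<^sub>L (\<pi>\<^sub>L (s\<^sub>R r)) = s\<^sub>R r"
    and sR_piR_tL: "s\<^sub>R (\<pi>\<^sub>R (t\<^sub>L l)) = t\<^sub>L l"
    and tR_piR_sL: "t\<^sub>R (\<pi>\<^sub>R (s\<^sub>L l)) = s\<^sub>L l"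
    and coproducts_left_right:
      "(coproduct_left \<gamma>\<^sub>L (tensor_rep (\<gamma>\<^sub>R a)), coproduct_right \<gamma>\<^sub>R (tensor_rep (\<gamma>\<^sub>L a)))
        \<in> tensor3_rel (lower_right t\<^sub>L) (lower_left s\<^sub>L) (upper_right s\<^sub>R) (upper_left t\<^sub>R)"
    and coproducts_right_left:
      "(coproduct_left \<gamma>\<^sub>R (tensor_rep (\<gamma>\<^sub>L a)), coproduct_right \<gamma>\<^sub>L (tensor_rep (\<gamma>\<^sub>R a)))
        \<in> tensor3_rel (upper_right s\<^sub>R) (upper_left t\<^sub>R) (lower_right t\<^sub>L) (lower_left s\<^sub>L)"
    and antipode_left: "S (t\<^sub>L l' * a * t\<^sub>L l) = s\<^sub>L l * S a * s\<^sub>L l'"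
    and antipode_right: "S (t\<^sub>R r' * a * t\<^sub>R r) = s\<^sub>R r * S a * s\<^sub>R r'"
    and antipode_coproduct_left: "sweedler (\<lambda>x y. S x * y) (\<gamma>\<^sub>L a) = s\<^sub>R (\<pi>\<^sub>R a)"
    and antipode_coproduct_right: "sweedler (\<lambda>x y. x * S y) (\<gamma>\<^sub>R a) = s\<^sub>L (\<pi>\<^sub>L a)"


section \<open>Duals and integrals\<close>

text \<open>The position of \<open>upper\<close>/\<open>lower\<close> and \<open>left\<close>/\<open>right\<close> in the names is that of the
  star: \<open>\<^sub>*\<A>\<close> is \<open>dual_lower_left\<close>, \<open>\<A>\<^sub>*\<close> is \<open>dual_lower_right\<close>, and so on.\<close>

definition dual_lower_left :: "('l::ring_1 \<Rightarrow> 'a::ring_1) \<Rightarrow> ('a \<Rightarrow> 'l) set"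
  where "dual_lower_left s = {\<rho>. left_hom (lower_left s) (*) \<rho>}"

definition dual_lower_right :: "('l::ring_1 \<Rightarrow> 'a::ring_1) \<Rightarrow> ('a \<Rightarrow> 'l) set"
  where "dual_lower_right t = {\<rho>. right_hom (lower_right t) (*) \<rho>}"

definition dual_upper_right :: "('r::ring_1 \<Rightarrow> 'a::ring_1) \<Rightarrow> ('a \<Rightarrow> 'r) set"
  where "dual_upper_right s = {\<phi>. right_hom (upper_right s) (*) \<phi>}"

definition dual_upper_left :: "('r::ring_1 \<Rightarrow> 'a::ring_1) \<Rightarrow> ('a \<Rightarrow> 'r) set"
  where "dual_upper_left t = {\<phi>. left_hom (upper_left t) (*) \<phi>}"

definition right_integrals_lower_left ::
  "('l::ring_1 \<Rightarrow> 'a::ring_1) \<Rightarrow> ('l \<Rightarrow> 'a) \<Rightarrow> ('a \<Rightarrow> ('a \<times> 'a \<Rightarrow>\<^sub>0 int) set) \<Rightarrow> ('a \<Rightarrow> 'l) set"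
  where "right_integrals_lower_left s t \<gamma> =
    {\<rho> \<in> dual_lower_left s. \<forall>a. sweedler (\<lambda>x y. t (\<rho> y) * x) (\<gamma> a) = s (\<rho> a)}"

definition right_integrals_lower_right ::
  "('l::ring_1 \<Rightarrow> 'a::ring_1) \<Rightarrow> ('l \<Rightarrow> 'a) \<Rightarrow> ('a \<Rightarrow> ('a \<times> 'a \<Rightarrow>\<^sub>0 int) set) \<Rightarrow> ('a \<Rightarrow> 'l) set"
  where "right_integrals_lower_right s t \<gamma> =
    {\<rho> \<in> dual_lower_right t. \<forall>a. sweedler (\<lambda>x y. s (\<rho> x) * y) (\<gamma> a) = t (\<rho> a)}"

definition left_integrals_upper_right ::
  "('r::ring_1 \<Rightarrow> 'a::ring_1) \<Rightarrow> ('r \<Rightarrow> 'a) \<Rightarrow> ('a \<Rightarrow> ('a \<times> 'a \<Rightarrow>\<^sub>0 int) set) \<Rightarrow> ('a \<Rightarrow> 'r) set"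
  where "left_integrals_upper_right s t \<gamma> =
    {\<phi> \<in> dual_upper_right s. \<forall>a. sweedler (\<lambda>x y. y * t (\<phi> x)) (\<gamma> a) = s (\<phi> a)}"

definition left_integrals_upper_left ::
  "('r::ring_1 \<Rightarrow> 'a::ring_1) \<Rightarrow> ('r \<Rightarrow> 'a) \<Rightarrow> ('a \<Rightarrow> ('a \<times> 'a \<Rightarrow>\<^sub>0 int) set) \<Rightarrow> ('a \<Rightarrow> 'r) set"
  where "left_integrals_upper_left s t \<gamma> =
    {\<phi> \<in> dual_upper_left t. \<forall>a. sweedler (\<lambda>x y. x * s (\<phi> y)) (\<gamma> a) = t (\<phi> a)}"

end

theory Submission
  imports Defs
begin

text \<open>
  The dual \<open>\<A>\<^sup>*\<close> carries the coaction \<open>\<phi> \<mapsto> (a \<mapsto> a\<^sup>2 t\<^sub>R(\<phi>(a\<^sup>1)))\<close> (\<open>coact\<close> below) and the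
  action \<open>(h \<cdot> \<phi>)(a) = \<phi>(S(h) a)\<close>, which together form a Hopf module whose coinvariants are the left
  integrals; \<open>twist \<phi> a h\<close> is the coaction of \<open>h \<cdot> \<phi>\<close> evaluated at \<open>a\<close>. A dual basis
  \<open>(b\<^sub>j, f\<^sub>j)\<close> of \<open>A\<^sub>L\<close> makes the projection onto the coinvariants explicit: for every \<open>\<phi>\<close> in
  \<open>\<A>\<^sup>*\<close>, with \<open>n\<^sub>j(a) = \<pi>\<^sub>R(s\<^sub>L(f\<^sub>j(a\<^sub>1)) a\<^sub>2)\<close>, the trace-like sum
  \<open>\<lambda>(a) = \<Sum>\<^sub>j n\<^sub>j(S\<^sup>2(coact \<phi> b\<^sub>j) a)\<close> is a left integral. If \<open>\<phi>\<close> runs through the functionals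
  \<open>\<xi>\<^sub>i\<close> of a dual basis \<open>(c\<^sub>i, \<xi>\<^sub>i)\<close> of \<open>A\<^sup>R\<close>, these integrals satisfy
  \<open>\<Sum>\<^sub>i \<lambda>\<^sub>i(S(c\<^sub>i)) = 1\<close>, so some \<open>\<lambda>\<close> has \<open>\<lambda> \<circ> S \<noteq> 0\<close>.

  The other three kinds of integrals come from this one. At \<open>a = 1\<close> the Hopf module law says that
  \<open>\<lambda> \<circ> S\<close> is a left integral on \<open>\<^sup>*\<A>\<close>, even if \<open>S\<close> is not bijective. Moreover integrals are linear
  on both sides over the base, and coassociativity between \<open>\<gamma>\<^sub>L\<close> and \<open>\<gamma>\<^sub>R\<close> turns left integrals on
  \<open>\<A>\<^sup>*\<close> and \<open>\<^sup>*\<A>\<close> into right integrals on \<open>\<A>\<^sub>*\<close> and \<open>\<^sub>*\<A>\<close> by identifying \<open>R\<close> with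
  \<open>L\<^sup>o\<^sup>p\<close> along \<open>\<pi>\<^sub>L s\<^sub>R\<close> and \<open>\<pi>\<^sub>L t\<^sub>R\<close>.
\<close>

section \<open>Evaluating balanced maps on tensors\<close>

definition frag_eval :: "('b \<Rightarrow> 'c::ring_1) \<Rightarrow> ('b \<Rightarrow>\<^sub>0 int) \<Rightarrow> 'c"
  where "frag_eval f u = (\<Sum>k\<in>Poly_Mapping.keys u. of_int (Poly_Mapping.lookup u k) * f k)"

lemma frag_eval_superset:
  assumes "finite K" "Poly_Mapping.keys u \<subseteq> K"
  shows "frag_eval f u = (\<Sum>k\<in>K. of_int (Poly_Mapping.lookup u k) * f k)"
  unfolding frag_eval_def
  by (rule sum.mono_neutral_left) (use assms in \<open>auto simp: in_keys_iff\<close>)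

lemma frag_eval_of [simp]: "frag_eval f (frag_of k) = f k"
  by (simp add: frag_eval_def)

lemma frag_eval_zero [simp]: "frag_eval f 0 = 0"
  by (simp add: frag_eval_def)

lemma frag_eval_diff: "frag_eval f (u - v) = frag_eval f u - frag_eval f v"
proof -
  let ?K = "Poly_Mapping.keys u \<union> Poly_Mapping.keys v"
  have "Poly_Mapping.keys (u - v) \<subseteq> ?K"
    by (auto simp: in_keys_iff lookup_minus)
  then show ?thesis
    by (simp add: frag_eval_superset [of ?K] lookup_minus algebra_simps sum_subtractf)
qed

lemma frag_eval_add: "frag_eval f (u + v) = frag_eval f u + frag_eval f v"
  using frag_eval_diff [of f "u + v" v] by (simp add: algebra_simps)

lemma frag_eval_extend: "frag_eval f (frag_extend g u) = frag_eval (\<lambda>k. frag_eval f (g k)) u"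
proof -
  have "Poly_Mapping.keys u \<subseteq> UNIV" by simp
  then show ?thesis
    by (induction u rule: frag_induction) (simp_all add: frag_extend_diff frag_eval_diff)
qed

lemma frag_eval_add_fun: "frag_eval (\<lambda>k. f k + g k) u = frag_eval f u + frag_eval g u"
  by (simp add: frag_eval_def algebra_simps sum.distrib)

lemma additiveD: "additive f \<Longrightarrow> f (x + y) = f x + f y"
  by (simp add: additive_def)

lemma additive_of_int_mult:
  assumes "additive h"
  shows "h (of_int n * (x::'a::ring_1)) = of_int n * (h x :: 'b::ring_1)"
proof -
  interpret additive h by fact
  have "h (of_nat m * x) = of_nat m * h x" for m
    by (induction m) (simp_all add: zero add algebra_simps)
  then show ?thesis
    by (cases n rule: int_cases2) (simp_all add: minus)
qed

lemma additive_frag_eval: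
  assumes "additive h"
  shows "h (frag_eval f u) = frag_eval (\<lambda>k. h (f k)) u"
  by (simp add: frag_eval_def additive.sum [OF assms] additive_of_int_mult [OF assms])

lemma frag_eval_diff_fun: "frag_eval (\<lambda>k. f k - g k) u = frag_eval f u - frag_eval g u"
  by (simp add: frag_eval_def algebra_simps sum_subtractf)

lemma frag_eval_swap:
  "frag_eval (\<lambda>k. frag_eval (f k) v) u = frag_eval (\<lambda>m. frag_eval (\<lambda>k. f k m) u) v"
proof -
  have "Poly_Mapping.keys u \<subseteq> UNIV" by simp
  then show ?thesis
  proof (induction u rule: frag_induction)
    case zero
    then show ?case by (simp add: frag_eval_def)
  next
    case (one x)
    then show ?case by simp
  next
    case (diff a b)
    then show ?case by (simp add: frag_eval_diff frag_eval_diff_fun)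
  qed
qed

lemma frag_eval_group_closure:
  assumes "\<And>w. w \<in> G \<Longrightarrow> frag_eval f w = 0" "u - v \<in> group_closure G"
  shows "frag_eval f u = frag_eval f v"
proof -
  from assms(2) have "frag_eval f (u - v) = 0"
    by (induction rule: group_closure.induct) (auto simp: assms(1) frag_eval_diff)
  then show ?thesis by (simp add: frag_eval_diff)
qed

text \<open>These maps factor through the tensor product; coproducts are used only through their
  values under such maps.\<close>

definition balanced2 ::
  "('m::ab_group_add \<Rightarrow> 'b \<Rightarrow> 'm) \<Rightarrow> ('b \<Rightarrow> 'n::ab_group_add \<Rightarrow> 'n) \<Rightarrow> ('m \<Rightarrow> 'n \<Rightarrow> 'c::ring_1) \<Rightarrow> bool"
  where "balanced2 ra la f \<longleftrightarrow>
    (\<forall>x x' y. f (x + x') y = f x y + f x' y) \<and>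
    (\<forall>x y y'. f x (y + y') = f x y + f x y') \<and>
    (\<forall>x b y. f (ra x b) y = f x (la b y))"

definition balanced3 ::
  "('m::ab_group_add \<Rightarrow> 'b \<Rightarrow> 'm) \<Rightarrow> ('b \<Rightarrow> 'n::ab_group_add \<Rightarrow> 'n) \<Rightarrow>
   ('n \<Rightarrow> 'd \<Rightarrow> 'n) \<Rightarrow> ('d \<Rightarrow> 'p::ab_group_add \<Rightarrow> 'p) \<Rightarrow> ('m \<Rightarrow> 'n \<Rightarrow> 'p \<Rightarrow> 'c::ring_1) \<Rightarrow> bool"
  where "balanced3 ra la ra' la' f \<longleftrightarrow>
    (\<forall>z. balanced2 ra la (\<lambda>x y. f x y z)) \<and> (\<forall>x. balanced2 ra' la' (f x))"

lemma balanced2_additive: "balanced2 ra la f \<Longrightarrow> additive (\<lambda>x. f x y)"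
  "balanced2 ra la f \<Longrightarrow> additive (f x)"
  by (auto simp: balanced2_def additive_def)

lemma frag_eval_tensor2_rel:
  assumes "balanced2 ra la f" "(u, v) \<in> tensor2_rel ra la"
  shows "frag_eval (\<lambda>(x, y). f x y) u = frag_eval (\<lambda>(x, y). f x y) v"
  by (rule frag_eval_group_closure [of "balancing2 ra la"])
    (use assms in \<open>auto simp: balancing2_def tensor2_rel_def frag_eval_diff balanced2_def\<close>)

lemma frag_eval_tensor3_rel:
  assumes "balanced3 ra la ra' la' f" "(u, v) \<in> tensor3_rel ra la ra' la'"
  shows "frag_eval (\<lambda>(x, y, z). f x y z) u = frag_eval (\<lambda>(x, y, z). f x y z) v"
  by (rule frag_eval_group_closure [of "balancing3 ra la ra' la'"])
    (use assms in \<open>auto simp: balancing3_def tensor3_rel_def frag_eval_diff balanced3_def balanced2_def\<close>)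

lemma sweedler_eval: "sweedler f X = frag_eval (\<lambda>(x, y). f x y) (tensor_rep X)"
  by (simp add: sweedler_def frag_eval_def Let_def case_prod_unfold)

text \<open>\<open>tensor_rep\<close> picks a member of the class, and a balanced map takes one
  value on all members.\<close>

lemma sweedler_class:
  assumes "balanced2 ra la f"
  shows "sweedler f (tensor2_rel ra la `` {u}) = frag_eval (\<lambda>(x, y). f x y) u"
proof -
  have "u \<in> tensor2_rel ra la `` {u}"
    by (simp add: tensor2_rel_def)
  then have "tensor_rep (tensor2_rel ra la `` {u}) \<in> tensor2_rel ra la `` {u}"
    unfolding tensor_rep_def by (rule someI)
  then show ?thesis
    unfolding sweedler_eval using frag_eval_tensor2_rel [OF assms] by simp
qed

lemma additive_sweedler: "additive h \<Longrightarrow> h (sweedler f X) = sweedler (\<lambda>x y. h (f x y)) X"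
  by (simp add: sweedler_eval additive_frag_eval case_prod_unfold)

lemma sweedler_add_fun: "sweedler (\<lambda>x y. f x y + g x y) X = sweedler f X + sweedler g X"
  by (simp add: sweedler_eval case_prod_unfold frag_eval_add_fun)

lemma sweedler_mult_left: "sweedler (\<lambda>x y. c * f x y) X = c * sweedler f X"
  by (rule additive_sweedler [symmetric]) (simp add: additive_def algebra_simps)

lemma sweedler_mult_right: "sweedler (\<lambda>x y. f x y * c) X = sweedler f X * c"
  by (rule additive_sweedler [symmetric, of "\<lambda>z. z * c"]) (simp add: additive_def algebra_simps)

lemma sweedler_zero [simp]: "sweedler (\<lambda>x y. 0) X = 0"
  by (simp add: sweedler_def Let_def)

lemma sweedler_sum_fun: "sweedler (\<lambda>x y. \<Sum>i\<in>I. f i x y) X = (\<Sum>i\<in>I. sweedler (f i) X)"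
  by (induction I rule: infinite_finite_induct) (simp_all add: sweedler_add_fun)

lemma frag_eval_tensor_map:
  "frag_eval (\<lambda>(x, y). f x y) (tensor_map g h u) = frag_eval (\<lambda>(x, y). f (g x) (h y)) u"
  by (simp add: tensor_map_def frag_eval_extend case_prod_unfold)

lemma frag_eval_tensor_mult:
  "frag_eval (\<lambda>(x, y). f x y) (tensor_mult u v) =
    frag_eval (\<lambda>(x, y). frag_eval (\<lambda>(x', y'). f (x * x') (y * y')) v) u"
  by (simp add: tensor_mult_def frag_eval_extend case_prod_unfold frag_eval_tensor_map [unfolded case_prod_unfold])

lemma frag_eval_coproduct_left:
  "frag_eval (\<lambda>(x, y, z). f x y z) (coproduct_left \<gamma> u) =
    frag_eval (\<lambda>(x, y). sweedler (\<lambda>x' x''. f x' x'' y) (\<gamma> x)) u"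
  by (simp add: coproduct_left_def frag_eval_extend case_prod_unfold sweedler_eval)

lemma frag_eval_coproduct_right:
  "frag_eval (\<lambda>(x, y, z). f x y z) (coproduct_right \<gamma> u) =
    frag_eval (\<lambda>(x, y). sweedler (\<lambda>y' y''. f x y' y'') (\<gamma> y)) u"
  by (simp add: coproduct_right_def frag_eval_extend case_prod_unfold sweedler_eval)

text \<open>Two coproducts and two tensors are allowed, so that the mixed axioms linking the left
  and the right coproduct are covered too.\<close>

lemma sweedler_coassociative:
  assumes "balanced3 ra la ra' la' F"
    and "(coproduct_left \<gamma> (tensor_rep X), coproduct_right \<gamma>' (tensor_rep Y)) \<in> tensor3_rel ra la ra' la'"
  shows "sweedler (\<lambda>x y. sweedler (\<lambda>x' x''. F x' x'' y) (\<gamma> x)) X =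
    sweedler (\<lambda>x y. sweedler (F x) (\<gamma>' y)) Y"
  using frag_eval_tensor3_rel [OF assms]
  by (simp add: frag_eval_coproduct_left frag_eval_coproduct_right sweedler_eval)


section \<open>Dual bases\<close>

text \<open>The functionals are the coordinates of the embedding \<open>i\<close>; finitely many
  suffice because each \<open>i m\<close> is supported where the images of the generators are. With
  \<open>smul\<close> abstract, right modules are covered as well.\<close>

lemma finite_dual_basis:
  fixes act :: "'r::ring_1 \<Rightarrow> 'm::ab_group_add \<Rightarrow> 'm"
    and smul :: "'r \<Rightarrow> 'r \<Rightarrow> 'r"
    and i :: "'m \<Rightarrow> ('m \<Rightarrow>\<^sub>0 'r)" and p :: "('m \<Rightarrow>\<^sub>0 'r) \<Rightarrow> 'm"
  assumes zero: "\<And>r. smul r 0 = 0" and one: "\<And>r. smul r 1 = r"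
    and add: "additive i" "additive p"
    and hom: "\<And>r x. i (act r x) = Poly_Mapping.map (smul r) (i x)"
      "\<And>r u. p (Poly_Mapping.map (smul r) u) = act r (p u)"
    and retract: "p \<circ> i = id"
    and fg: "finite X" "\<And>m. \<exists>c. m = (\<Sum>x\<in>X. act (c x) x)"
  obtains Y \<xi> b where "finite (Y :: 'm set)" "\<And>y. additive (\<xi> y)"
    "\<And>y r m. \<xi> y (act r m) = smul r (\<xi> y m)" "\<And>m. m = (\<Sum>y\<in>Y. act (\<xi> y m) (b y))"
proof -
  have lookup_map: "Poly_Mapping.lookup (Poly_Mapping.map (smul r) u) k = smul r (Poly_Mapping.lookup u k)"
    for r and u :: "'m \<Rightarrow>\<^sub>0 'r" and k
    by (simp add: map.rep_eq when_def zero)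
  define Y where "Y = (\<Union>x\<in>X. Poly_Mapping.keys (i x))"
  define b where "b y = p (Poly_Mapping.single y 1)" for y
  have fin: "finite Y" using fg(1) by (simp add: Y_def)
  have keys: "Poly_Mapping.keys (i m) \<subseteq> Y" for m
  proof -
    obtain c where m: "m = (\<Sum>x\<in>X. act (c x) x)" using fg(2) by blast
    have "Poly_Mapping.lookup (i m) k = (\<Sum>x\<in>X. smul (c x) (Poly_Mapping.lookup (i x) k))" for k
      by (subst m) (simp add: additive.sum [OF add(1)] hom lookup_sum lookup_map)
    then show ?thesis
      by (auto simp: Y_def in_keys_iff) (metis (no_types, lifting) sum.neutral zero)
  qed
  have "m = (\<Sum>y\<in>Y. act (Poly_Mapping.lookup (i m) y) (b y))" for m
  proof -
    have "i m = (\<Sum>y\<in>Y. Poly_Mapping.map (smul (Poly_Mapping.lookup (i m) y)) (Poly_Mapping.single y 1))"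
      using keys [of m] fin
      by (intro poly_mapping_eqI)
        (auto simp: lookup_sum lookup_map lookup_single when_def if_distrib zero one in_keys_iff cong: if_cong)
    then have "p (i m) = (\<Sum>y\<in>Y. act (Poly_Mapping.lookup (i m) y) (b y))"
      by (metis (no_types, lifting) additive.sum [OF add(2)] hom(2) b_def sum.cong)
    then show ?thesis using retract by (metis comp_apply id_apply)
  qed
  then show thesis
    using that [of Y "\<lambda>y m. Poly_Mapping.lookup (i m) y" b] fin add(1)
    by (simp add: additive_def lookup_add hom lookup_map)
qed

lemma right_dual_basis:
  fixes act :: "'m::ab_group_add \<Rightarrow> 'r::ring_1 \<Rightarrow> 'm"
  assumes "right_finitely_generated act" "right_projective act"
  obtains Y \<xi> b where "finite (Y :: 'm set)" "\<And>y. right_hom act (*) (\<xi> y)" "\<And>m. m = (\<Sum>y\<in>Y. act (b y) (\<xi> y m))"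
proof -
  obtain X where X: "finite X" "\<And>m. \<exists>c. m = (\<Sum>x\<in>X. act x (c x))"
    using assms(1) by (auto simp: right_finitely_generated_def)
  obtain i :: "'m \<Rightarrow> ('m \<Rightarrow>\<^sub>0 'r)" and p where
      i: "right_hom act (\<lambda>u r. Poly_Mapping.map (\<lambda>c. c * r) u) i"
      and p: "right_hom (\<lambda>u r. Poly_Mapping.map (\<lambda>c. c * r) u) act p" and pi: "p \<circ> i = id"
    using assms(2) unfolding right_projective_def by blast
  show thesis
  proof (rule finite_dual_basis [of "\<lambda>r c. c * r" i p "\<lambda>r m. act m r" X])
    show "\<exists>c. m = (\<Sum>x\<in>X. act x (c x))" for m by (rule X)
  next
    fix Y :: "'m set" and \<xi> b
    assume "finite Y" "\<And>y. additive (\<xi> y)"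
      "\<And>y r m. \<xi> y (act m r) = \<xi> y m * r" "\<And>m. m = (\<Sum>y\<in>Y. act (b y) (\<xi> y m))"
    then show thesis
      by (intro that [of Y \<xi> b]) (simp_all add: right_hom_def)
  qed (use X(1) i p pi in \<open>simp_all add: right_hom_def\<close>)
qed


section \<open>Bialgebroids\<close>

context left_bialgebroid
begin

abbreviation bal :: "('a \<Rightarrow> 'a \<Rightarrow> 'a) \<Rightarrow> bool"
  where "bal \<equiv> balanced2 (lower_right t) (lower_left s)"

lemma bal_iff:
  "bal f \<longleftrightarrow> (\<forall>x x' y. f (x + x') y = f x y + f x' y) \<and> (\<forall>x y y'. f x (y + y') = f x y + f x y') \<and>
    (\<forall>l x y. f (t l * x) y = f x (s l * y))"
  by (auto simp: balanced2_def lower_left_def lower_right_def)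

lemma sweedler_additive: "bal f \<Longrightarrow> additive (\<lambda>a. sweedler f (\<gamma> a))"
  by (simp add: additive_def coproduct_add sweedler_class frag_eval_add) (simp add: sweedler_eval)

lemma sweedler_source_target_left:
  "bal f \<Longrightarrow> sweedler f (\<gamma> (s l * t l' * a)) = sweedler (\<lambda>x y. f (s l * x) (t l' * y)) (\<gamma> a)"
  by (simp add: coproduct_bimodule sweedler_class frag_eval_tensor_map) (simp add: sweedler_eval)

lemma sweedler_source_left:
  "bal f \<Longrightarrow> sweedler f (\<gamma> (s l * a)) = sweedler (\<lambda>x y. f (s l * x) y) (\<gamma> a)"
  using sweedler_source_target_left [of f l 1 a] by (simp add: target.map_one)

lemma sweedler_target_left:
  "bal f \<Longrightarrow> sweedler f (\<gamma> (t l * a)) = sweedler (\<lambda>x y. f x (t l * y)) (\<gamma> a)"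
  using sweedler_source_target_left [of f 1 l a] by (simp add: source.map_one)

lemma sweedler_one: "bal f \<Longrightarrow> sweedler f (\<gamma> 1) = f 1 1"
  by (simp add: coproduct_one sweedler_class)

lemma sweedler_mult:
  "bal f \<Longrightarrow> sweedler f (\<gamma> (a * b)) =
    sweedler (\<lambda>x' y'. sweedler (\<lambda>x y. f (x * x') (y * y')) (\<gamma> a)) (\<gamma> b)"
  by (simp add: coproduct_mult sweedler_class frag_eval_tensor_mult)
    (simp add: sweedler_eval case_prod_unfold frag_eval_swap [of _ "tensor_rep (\<gamma> b)"])

lemma sweedler_takeuchi:
  "bal f \<Longrightarrow> sweedler (\<lambda>x y. f (x * t l) y) (\<gamma> a) = sweedler (\<lambda>x y. f x (y * s l)) (\<gamma> a)"
  using frag_eval_tensor2_rel [OF _ takeuchi [of l a], of f]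
  by (simp add: frag_eval_tensor_map sweedler_eval)

text \<open>By the Takeuchi condition a right factor \<open>t l\<close> of \<open>x\<close> may be
  traded for a right factor \<open>s l\<close> of \<open>y\<close>; hence the product of coproducts
  is well defined in its second factor.\<close>

lemma bal_mult:
  assumes "bal f"
  shows "bal (\<lambda>x' y'. sweedler (\<lambda>x y. f (x * x') (y * y')) (\<gamma> a))"
proof -
  have "bal (\<lambda>x y. f (x * x') (y * y'))" for x' y'
    using assms by (simp add: bal_iff algebra_simps)
  then show ?thesis
    using assms sweedler_takeuchi [of "\<lambda>x y. f (x * _) (y * _)"]
    by (simp add: bal_iff algebra_simps sweedler_add_fun)
qed

lemma bal_source_left: "bal f \<Longrightarrow> bal (\<lambda>x y. f (s l * x) y)"
  by (simp add: bal_iff algebra_simps) (metis mult.assoc source_target_commute)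

lemma bal_target_left: "bal f \<Longrightarrow> bal (\<lambda>x y. f x (t l * y))"
  by (simp add: bal_iff algebra_simps) (metis mult.assoc source_target_commute)

text \<open>The bimodule axiom concerns left factors; a right factor \<open>s l\<close> is handled
  by multiplicativity and the coproduct of \<open>s l * 1\<close>.\<close>

lemma sweedler_source_right:
  assumes "bal f"
  shows "sweedler f (\<gamma> (a * s l)) = sweedler (\<lambda>x y. f (x * s l) y) (\<gamma> a)"
  using sweedler_mult [OF assms, of a "s l * 1"] sweedler_source_left [OF bal_mult [OF assms], of a l 1]
    sweedler_one [OF bal_source_left [OF bal_mult [OF assms]], of l a]
  by simp

lemma sweedler_target_right:
  assumes "bal f"
  shows "sweedler f (\<gamma> (a * t l)) = sweedler (\<lambda>x y. f x (y * t l)) (\<gamma> a)"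
  using sweedler_mult [OF assms, of a "t l * 1"] sweedler_target_left [OF bal_mult [OF assms], of a l 1]
    sweedler_one [OF bal_target_left [OF bal_mult [OF assms]], of l a]
  by simp

lemma counit_source: "\<pi> (s l * a) = l * \<pi> a"
  using counit_bimodule [of l 1 a] by (simp add: target.map_one)

lemma counit_target: "\<pi> (t l * a) = \<pi> a * l"
  using counit_bimodule [of 1 l a] by (simp add: source.map_one)

end

section \<open>Sums over the coproduct of a right bialgebroid\<close>

context right_bialgebroid
begin

abbreviation bal :: "('a \<Rightarrow> 'a \<Rightarrow> 'a) \<Rightarrow> bool"
  where "bal \<equiv> balanced2 (upper_right s) (upper_left t)"

lemma bal_iff:
  "bal f \<longleftrightarrow> (\<forall>x x' y. f (x + x') y = f x y + f x' y) \<and> (\<forall>x y y'. f x (y + y') = f x y + f x y') \<and>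
    (\<forall>r x y. f (x * s r) y = f x (y * t r))"
  by (auto simp: balanced2_def upper_left_def upper_right_def)

lemma sweedler_additive: "bal f \<Longrightarrow> additive (\<lambda>a. sweedler f (\<gamma> a))"
  by (simp add: additive_def coproduct_add sweedler_class frag_eval_add) (simp add: sweedler_eval)

lemma sweedler_source_target_right:
  "bal f \<Longrightarrow> sweedler f (\<gamma> (a * s r' * t r)) = sweedler (\<lambda>x y. f (x * t r) (y * s r')) (\<gamma> a)"
  by (simp add: coproduct_bimodule sweedler_class frag_eval_tensor_map) (simp add: sweedler_eval)

lemma sweedler_source_right:
  "bal f \<Longrightarrow> sweedler f (\<gamma> (a * s r)) = sweedler (\<lambda>x y. f x (y * s r)) (\<gamma> a)"
  using sweedler_source_target_right [of f a r 1] by (simp add: target.map_one)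

lemma sweedler_target_right:
  "bal f \<Longrightarrow> sweedler f (\<gamma> (a * t r)) = sweedler (\<lambda>x y. f (x * t r) y) (\<gamma> a)"
  using sweedler_source_target_right [of f a 1 r] by (simp add: source.map_one)

lemma sweedler_one: "bal f \<Longrightarrow> sweedler f (\<gamma> 1) = f 1 1"
  by (simp add: coproduct_one sweedler_class)

lemma sweedler_mult:
  "bal f \<Longrightarrow> sweedler f (\<gamma> (a * b)) =
    sweedler (\<lambda>x y. sweedler (\<lambda>x' y'. f (x * x') (y * y')) (\<gamma> b)) (\<gamma> a)"
  by (simp add: coproduct_mult sweedler_class frag_eval_tensor_mult) (simp add: sweedler_eval)

lemma sweedler_takeuchi:
  "bal f \<Longrightarrow> sweedler (\<lambda>x y. f (s r * x) y) (\<gamma> a) = sweedler (\<lambda>x y. f x (t r * y)) (\<gamma> a)"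
  using frag_eval_tensor2_rel [OF _ takeuchi [of r a], of f]
  by (simp add: frag_eval_tensor_map sweedler_eval)

lemma bal_mult:
  assumes "bal f"
  shows "bal (\<lambda>x y. sweedler (\<lambda>x' y'. f (x * x') (y * y')) (\<gamma> a))"
proof -
  have "bal (\<lambda>x' y'. f (x * x') (y * y'))" for x y
    using assms by (simp add: bal_iff algebra_simps flip: mult.assoc)
  then show ?thesis
    using assms sweedler_takeuchi [of "\<lambda>x y. f (_ * x) (_ * y)"]
    by (simp add: bal_iff algebra_simps sweedler_add_fun)
qed

lemma bal_source_right: "bal f \<Longrightarrow> bal (\<lambda>x y. f x (y * s r))"
  by (simp add: bal_iff algebra_simps) (metis mult.assoc source_target_commute)

lemma bal_target_right: "bal f \<Longrightarrow> bal (\<lambda>x y. f (x * t r) y)"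
  by (simp add: bal_iff algebra_simps) (metis mult.assoc source_target_commute)

lemma sweedler_source_left:
  assumes "bal f"
  shows "sweedler f (\<gamma> (s r * a)) = sweedler (\<lambda>x y. f x (s r * y)) (\<gamma> a)"
  using sweedler_mult [OF assms, of "1 * s r" a] sweedler_source_right [OF bal_mult [OF assms], of a 1 r]
    sweedler_one [OF bal_source_right [OF bal_mult [OF assms]], of r a]
  by simp

lemma sweedler_target_left:
  assumes "bal f"
  shows "sweedler f (\<gamma> (t r * a)) = sweedler (\<lambda>x y. f (t r * x) y) (\<gamma> a)"
  using sweedler_mult [OF assms, of "1 * t r" a] sweedler_target_right [OF bal_mult [OF assms], of a 1 r]
    sweedler_one [OF bal_target_right [OF bal_mult [OF assms]], of r a]
  by simp

lemma counit_source: "\<pi> (a * s r) = \<pi> a * r"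
  using counit_bimodule [of a r 1] by (simp add: target.map_one)

lemma counit_target: "\<pi> (a * t r) = r * \<pi> a"
  using counit_bimodule [of a 1 r] by (simp add: source.map_one)

end


section \<open>The antipode\<close>

context hopf_algebroid
begin

section \<open>The antipode and the images of the base algebras\<close>

lemma sL_sR_commute: "s\<^sub>L l * s\<^sub>R r = s\<^sub>R r * s\<^sub>L l"
  by (metis left.source_target_commute tL_piL_sR)

lemma antipode_tL_left: "S (t\<^sub>L l * a) = S a * s\<^sub>L l"
  using antipode_left [of l a 1] by (simp add: left.target.map_one left.source.map_one)

lemma antipode_tR_left: "S (t\<^sub>R r * a) = S a * s\<^sub>R r"
  using antipode_right [of r a 1] by (simp add: right.target.map_one right.source.map_one)

lemma antipode_tR_right: "S (a * t\<^sub>R r) = s\<^sub>R r * S a"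
  using antipode_right [of 1 a r] by (simp add: right.target.map_one right.source.map_one)

text \<open>Each \<open>s\<^sub>L l\<close> is a value of \<open>t\<^sub>R\<close>, so the antipode
  axiom for \<open>t\<^sub>R\<close> also governs factors \<open>s\<^sub>L l\<close>.\<close>

lemma antipode_sL_left: "S (s\<^sub>L l * a) = S a * s\<^sub>R (\<pi>\<^sub>R (s\<^sub>L l))"
  by (metis antipode_tR_left tR_piR_sL)

lemma antipode_sL_right: "S (a * s\<^sub>L l) = s\<^sub>R (\<pi>\<^sub>R (s\<^sub>L l)) * S a"
  by (metis antipode_tR_right tR_piR_sL)

lemma bal_antipode_left: "left.bal (\<lambda>x y. S x * y)"
  by (simp add: left.bal_iff algebra_simps antipode.add antipode_tL_left)

lemma antipode_one: "S 1 = 1"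
  using antipode_coproduct_left [of 1] left.sweedler_one [OF bal_antipode_left]
  by (simp add: right.counit_one right.source.map_one)

lemma sweedler_coassociative_left_right:
  assumes "\<And>z. left.bal (\<lambda>x y. F x y z)" "\<And>x. right.bal (F x)"
  shows "sweedler (\<lambda>x y. sweedler (\<lambda>x' x''. F x' x'' y) (\<gamma>\<^sub>L x)) (\<gamma>\<^sub>R a) =
    sweedler (\<lambda>x y. sweedler (F x) (\<gamma>\<^sub>R y)) (\<gamma>\<^sub>L a)"
  by (rule sweedler_coassociative [OF _ coproducts_left_right]) (use assms in \<open>simp add: balanced3_def\<close>)

lemma sweedler_coassociative_right_left:
  assumes "\<And>z. right.bal (\<lambda>x y. F x y z)" "\<And>x. left.bal (F x)"
  shows "sweedler (\<lambda>x y. sweedler (\<lambda>x' x''. F x' x'' y) (\<gamma>\<^sub>R x)) (\<gamma>\<^sub>L a) =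
    sweedler (\<lambda>x y. sweedler (F x) (\<gamma>\<^sub>L y)) (\<gamma>\<^sub>R a)"
  by (rule sweedler_coassociative [OF _ coproducts_right_left]) (use assms in \<open>simp add: balanced3_def\<close>)

lemma sweedler_coassociative_left_left:
  assumes "\<And>z. left.bal (\<lambda>x y. F x y z)" "\<And>x. left.bal (F x)"
  shows "sweedler (\<lambda>x y. sweedler (\<lambda>x' x''. F x' x'' y) (\<gamma>\<^sub>L x)) (\<gamma>\<^sub>L a) =
    sweedler (\<lambda>x y. sweedler (F x) (\<gamma>\<^sub>L y)) (\<gamma>\<^sub>L a)"
  by (rule sweedler_coassociative [OF _ left.coassociative]) (use assms in \<open>simp add: balanced3_def\<close>)

text \<open>Two balanced maps agreeing on all \<open>h\<^sub>1 \<otimes> h\<^sub>2 k\<close> agree, since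
  \<open>h \<otimes> k \<mapsto> h\<^sub>1 \<otimes> h\<^sub>2 k\<close> has the inverse \<open>h \<otimes> k \<mapsto> h\<^sup>1 \<otimes> S(h\<^sup>2) k\<close>. This replaces the
  usual convolution argument in proving that \<open>S\<close> reverses products and coproducts.\<close>

lemma galois_inverse:
  assumes X: "left.bal X"
  shows "sweedler (\<lambda>p q. sweedler (\<lambda>h k. X h (k * S q)) (\<gamma>\<^sub>L p)) (\<gamma>\<^sub>R a) = X a 1"
proof -
  have "sweedler (\<lambda>p q. sweedler (\<lambda>h k. X h (k * S q)) (\<gamma>\<^sub>L p)) (\<gamma>\<^sub>R a) =
      sweedler (\<lambda>x y. sweedler (\<lambda>y' y''. X x (y' * S y'')) (\<gamma>\<^sub>R y)) (\<gamma>\<^sub>L a)"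
    by (rule sweedler_coassociative_left_right)
      (use X in \<open>simp_all add: left.bal_iff right.bal_iff algebra_simps antipode.add antipode_tR_right\<close>)
  also have "\<dots> = sweedler (\<lambda>x y. X x (s\<^sub>L (\<pi>\<^sub>L y))) (\<gamma>\<^sub>L a)"
    by (simp add: additive_sweedler [OF balanced2_additive(2) [OF X], symmetric] antipode_coproduct_right)
  also have "\<dots> = sweedler (\<lambda>x y. X (t\<^sub>L (\<pi>\<^sub>L y) * x) 1) (\<gamma>\<^sub>L a)"
    using X by (simp add: left.bal_iff)
  also have "\<dots> = X a 1"
    by (simp add: additive_sweedler [OF balanced2_additive(1) [OF X], symmetric] left.counit_right)
  finally show ?thesis .
qed

lemma galois_cancel:
  assumes X: "left.bal X" and Y: "left.bal Y"
    and eq: "\<And>h k. sweedler (\<lambda>x y. X x (y * k)) (\<gamma>\<^sub>L h) = sweedler (\<lambda>x y. Y x (y * k)) (\<gamma>\<^sub>L h)"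
  shows "X h k = Y h k"
proof -
  have "left.bal (\<lambda>x y. X x (y * k))" "left.bal (\<lambda>x y. Y x (y * k))"
    using X Y by (simp_all add: left.bal_iff algebra_simps)
  from this [THEN galois_inverse, of h] show ?thesis
    by (simp add: mult.assoc eq)
qed

text \<open>Galois cancellation is used twice. Cancelling in \<open>b\<close> shows that S(a_1 b)
  a_2 c equals S(b) s_R(\<pi>_R(a)) c, which is S(b) S(a_1) a_2 c; cancelling in \<open>a\<close>
  then gives the claim.\<close>

theorem antipode_mult: "S (a * b) = S b * S a"
proof -
  have "sweedler (\<lambda>h k. S (h * b) * (k * c)) (\<gamma>\<^sub>L a) = S b * s\<^sub>R (\<pi>\<^sub>R a) * c" for a c
  proof (rule galois_cancel [where h = b and k = c])
    show "left.bal (\<lambda>b c. sweedler (\<lambda>h k. S (h * b) * (k * c)) (\<gamma>\<^sub>L a))"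
      by (rule left.bal_mult [OF bal_antipode_left])
    show "left.bal (\<lambda>b c. S b * s\<^sub>R (\<pi>\<^sub>R a) * c)"
      by (simp add: left.bal_iff algebra_simps antipode.add antipode_tL_left)
        (metis mult.assoc sL_sR_commute)
    fix b c
    have "sweedler (\<lambda>x y. sweedler (\<lambda>h k. S (h * x) * (k * (y * c))) (\<gamma>\<^sub>L a)) (\<gamma>\<^sub>L b) =
        sweedler (\<lambda>x y. S x * y) (\<gamma>\<^sub>L (a * b)) * c"
      by (simp add: left.sweedler_mult [OF bal_antipode_left] flip: mult.assoc sweedler_mult_right)
    \<comment> \<open>By the counit axiom, \<open>a\<close> may be replaced by
      \<open>t\<^sub>R (\<pi>\<^sub>R a)\<close>. This is a value of \<open>s\<^sub>L\<close>, so as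
      a left factor it acts on the first leg of the left coproduct alone.\<close>
    also have "\<dots> = s\<^sub>R (\<pi>\<^sub>R (t\<^sub>R (\<pi>\<^sub>R a) * b)) * c"
      by (simp add: antipode_coproduct_left right.counit_mult_target)
    also have "s\<^sub>R (\<pi>\<^sub>R (t\<^sub>R (\<pi>\<^sub>R a) * b)) = sweedler (\<lambda>x y. S x * y) (\<gamma>\<^sub>L (s\<^sub>L (\<pi>\<^sub>L (t\<^sub>R (\<pi>\<^sub>R a))) * b))"
      by (simp add: antipode_coproduct_left sL_piL_tR)
    also have "\<dots> = sweedler (\<lambda>x y. S x * s\<^sub>R (\<pi>\<^sub>R a) * y) (\<gamma>\<^sub>L b)"
      by (subst left.sweedler_source_left [OF bal_antipode_left]) (simp add: sL_piL_tR antipode_tR_left)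
    finally show "sweedler (\<lambda>x y. sweedler (\<lambda>h k. S (h * x) * (k * (y * c))) (\<gamma>\<^sub>L a)) (\<gamma>\<^sub>L b) =
        sweedler (\<lambda>x y. S x * s\<^sub>R (\<pi>\<^sub>R a) * (y * c)) (\<gamma>\<^sub>L b)"
      by (simp flip: mult.assoc sweedler_mult_right)
  qed
  then have eq: "sweedler (\<lambda>h k. S (h * b) * (k * c)) (\<gamma>\<^sub>L a) = S b * s\<^sub>R (\<pi>\<^sub>R a) * c" for a c .
  have "S (a * b) * 1 = S b * S a * 1"
  proof (rule galois_cancel [of "\<lambda>h k. S (h * b) * k" "\<lambda>h k. S b * S h * k"])
    show "left.bal (\<lambda>h k. S (h * b) * k)" "left.bal (\<lambda>h k. S b * S h * k)"
      by (simp_all add: left.bal_iff algebra_simps antipode.add antipode_tL_left)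
    show "sweedler (\<lambda>x y. S (x * b) * (y * k)) (\<gamma>\<^sub>L h) = sweedler (\<lambda>x y. S b * S x * (y * k)) (\<gamma>\<^sub>L h)" for h k
      by (simp add: eq antipode_coproduct_left [of h, symmetric] flip: sweedler_mult_left sweedler_mult_right)
        (simp add: mult.assoc)
  qed
  then show ?thesis by simp
qed

text \<open>\<open>X\<close> and \<open>Y\<close> carry an additional right factor \<open>k\<close>,
  as cancellation requires. On h_1 \<otimes> h_2 k both give the value of \<open>F\<close> at k^1
  \<otimes> s_R(\<pi>_R(h)) k^2; the claim is the case k = 1.\<close>

theorem coproduct_antipode:
  assumes F: "right.bal F"
  shows "sweedler F (\<gamma>\<^sub>R (S a)) = sweedler (\<lambda>x y. F (S y) (S x)) (\<gamma>\<^sub>L a)"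
proof -
  define X where "X h k = sweedler F (\<gamma>\<^sub>R (S h * k))" for h k
  define T where "T h k = sweedler (\<lambda>x y. F (h * x) (k * y))" for h k
  define Y where "Y h k = sweedler (\<lambda>x y. T (S y) (S x) (\<gamma>\<^sub>R k)) (\<gamma>\<^sub>L h)" for h k
  have balT: "right.bal (\<lambda>x y. F (h * x) (k * y))" for h k
    using F by (simp add: right.bal_iff algebra_simps flip: mult.assoc)
  note add_F = additiveD [OF right.sweedler_additive [OF F]]
  have T_add: "T (h + h') k Z = T h k Z + T h' k Z" "T h (k + k') Z = T h k Z + T h k' Z" for h h' k k' Z
    using F by (simp_all add: T_def right.bal_iff distrib_right sweedler_add_fun)
  have T_add3: "T h k (\<gamma>\<^sub>R (c + c')) = T h k (\<gamma>\<^sub>R c) + T h k (\<gamma>\<^sub>R c')" for h k c c'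
    unfolding T_def by (rule additiveD [OF right.sweedler_additive [OF balT]])
  have T_takeuchi: "T (h * s\<^sub>R r) k (\<gamma>\<^sub>R c) = T h (k * t\<^sub>R r) (\<gamma>\<^sub>R c)" for h k r c
    using right.sweedler_takeuchi [OF balT [of h k], of r c] by (simp add: T_def mult.assoc)
  have T_takeuchi': "T (h * s\<^sub>R (\<pi>\<^sub>R (s\<^sub>L l))) k (\<gamma>\<^sub>R c) = T h (k * s\<^sub>L l) (\<gamma>\<^sub>R c)" for h k l c
    using T_takeuchi [of h "\<pi>\<^sub>R (s\<^sub>L l)" k c] by (simp add: tR_piR_sL)
  have T_left: "T h k (\<gamma>\<^sub>R (s\<^sub>L l * c)) = T (h * s\<^sub>L l) k (\<gamma>\<^sub>R c)" for h k l c
    using right.sweedler_target_left [OF balT [of h k], of "\<pi>\<^sub>R (s\<^sub>L l)" c]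
    by (simp add: T_def tR_piR_sL mult.assoc)
  have bal_inner: "left.bal (\<lambda>x y. T (S y) (S x) (\<gamma>\<^sub>R k))" for k
    by (simp add: left.bal_iff antipode.add T_add antipode_tL_left antipode_sL_left T_takeuchi')
  have "X h k = Y h k" for h k
  proof (rule galois_cancel [of X Y])
    show "left.bal X"
      by (simp add: left.bal_iff X_def antipode.add algebra_simps add_F antipode_tL_left)
    show "left.bal Y"
      using left.sweedler_target_left [OF bal_inner] additiveD [OF left.sweedler_additive [OF bal_inner]]
      by (simp add: left.bal_iff Y_def T_add3 sweedler_add_fun antipode_tL_left T_left)
    fix h k
    have "additive (\<lambda>z. sweedler F (\<gamma>\<^sub>R (z * k)))"
      by (simp add: additive_def distrib_right add_F)
    from additive_sweedler [OF this, of "\<lambda>x y. S x * y" "\<gamma>\<^sub>L h"]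
    have X: "sweedler (\<lambda>x y. X x (y * k)) (\<gamma>\<^sub>L h) = T 1 (s\<^sub>R (\<pi>\<^sub>R h)) (\<gamma>\<^sub>R k)"
      by (simp add: X_def T_def mult.assoc antipode_coproduct_left right.sweedler_source_left [OF F])
    have eq1: "T (S y) (S x) (\<gamma>\<^sub>R (k' * k)) =
        sweedler (\<lambda>u v. T (S y * u) (S x * v) (\<gamma>\<^sub>R k)) (\<gamma>\<^sub>R k')" for x y k'
      unfolding T_def by (subst right.sweedler_mult [OF balT]) (simp add: mult.assoc)
    \<comment> \<open>Mixed coassociativity brings together the two legs of m^1, whose product under
      the antipode identity is s_R(\<pi>_R(m^1)). The Takeuchi condition carries this to the second
      argument, where the counit law turns m^2 t_R(\<pi>_R(m^1)) into m.\<close>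
    have eq2: "sweedler (\<lambda>y k'. T (S y) (S x) (\<gamma>\<^sub>R (k' * k))) (\<gamma>\<^sub>L m) = T 1 (S x * m) (\<gamma>\<^sub>R k)" for x m
    proof -
      have "sweedler (\<lambda>y k'. T (S y) (S x) (\<gamma>\<^sub>R (k' * k))) (\<gamma>\<^sub>L m) =
          sweedler (\<lambda>u v. sweedler (\<lambda>y u'. T (S y * u') (S x * v) (\<gamma>\<^sub>R k)) (\<gamma>\<^sub>L u)) (\<gamma>\<^sub>R m)"
        unfolding eq1
        by (rule sweedler_coassociative_left_right [symmetric])
          (simp_all add: left.bal_iff right.bal_iff antipode.add antipode_tL_left T_add distrib_left
            distrib_right mult.assoc T_takeuchi flip: T_takeuchi mult.assoc)
      also have "\<dots> = sweedler (\<lambda>u v. T (s\<^sub>R (\<pi>\<^sub>R u)) (S x * v) (\<gamma>\<^sub>R k)) (\<gamma>\<^sub>R m)"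
      proof -
        have "additive (\<lambda>z. T z (S x * v) (\<gamma>\<^sub>R k))" for v
          by (simp add: additive_def T_add)
        from additive_sweedler [OF this, of "\<lambda>x y. S x * y", symmetric] show ?thesis
          by (simp add: antipode_coproduct_left)
      qed
      also have "\<dots> = sweedler (\<lambda>u v. T 1 (S x * (v * t\<^sub>R (\<pi>\<^sub>R u))) (\<gamma>\<^sub>R k)) (\<gamma>\<^sub>R m)"
        using T_takeuchi [of 1] by (simp add: mult.assoc)
      also have "\<dots> = T 1 (S x * m) (\<gamma>\<^sub>R k)"
      proof -
        have "additive (\<lambda>z. T 1 (S x * z) (\<gamma>\<^sub>R k))"
          by (simp add: additive_def T_add distrib_left)
        from additive_sweedler [OF this, of "\<lambda>u v. v * t\<^sub>R (\<pi>\<^sub>R u)" "\<gamma>\<^sub>R m", symmetric] show ?thesis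
          by (simp add: right.counit_left)
      qed
      finally show ?thesis .
    qed
    \<comment> \<open>Coassociativity regroups the three legs of \<open>h\<close> so that
      \<open>eq2\<close> applies to the last two.\<close>
    have "sweedler (\<lambda>x y. Y x (y * k)) (\<gamma>\<^sub>L h) =
        sweedler (\<lambda>x m. sweedler (\<lambda>y k'. T (S y) (S x) (\<gamma>\<^sub>R (k' * k))) (\<gamma>\<^sub>L m)) (\<gamma>\<^sub>L h)"
      unfolding Y_def
      by (rule sweedler_coassociative_left_left)
        (simp_all add: bal_inner left.bal_iff antipode.add T_add T_add3 distrib_right antipode_tL_left
          mult.assoc T_left)
    also have "\<dots> = T 1 (sweedler (\<lambda>x m. S x * m) (\<gamma>\<^sub>L h)) (\<gamma>\<^sub>R k)"
      unfolding eq2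
      by (rule additive_sweedler [symmetric]) (simp add: additive_def T_add)
    finally show "sweedler (\<lambda>x y. X x (y * k)) (\<gamma>\<^sub>L h) = sweedler (\<lambda>x y. Y x (y * k)) (\<gamma>\<^sub>L h)"
      by (simp add: X antipode_coproduct_left)
  qed
  from this [of a 1] show ?thesis
    by (simp add: X_def Y_def T_def right.sweedler_one [OF balT])
qed

section \<open>The Hopf module structure of the dual \<open>\<A>\<^sup>*\<close>\<close>

definition coact :: "('a \<Rightarrow> 'r) \<Rightarrow> 'a \<Rightarrow> 'a"
  where "coact \<phi> a = sweedler (\<lambda>x y. y * t\<^sub>R (\<phi> x)) (\<gamma>\<^sub>R a)"

lemma dual_upper_right_iff:
  "\<phi> \<in> dual_upper_right s\<^sub>R \<longleftrightarrow> (\<forall>x y. \<phi> (x + y) = \<phi> x + \<phi> y) \<and> (\<forall>x r. \<phi> (x * s\<^sub>R r) = \<phi> x * r)"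
  by (simp add: dual_upper_right_def right_hom_def additive_def upper_right_def)

lemma coact_bal:
  assumes "\<phi> \<in> dual_upper_right s\<^sub>R"
  shows "right.bal (\<lambda>x y. h * (y * t\<^sub>R (\<phi> x)))" "right.bal (\<lambda>x y. h * (y * t\<^sub>R (\<phi> (k * x))))"
  using assms
  by (simp_all add: dual_upper_right_iff right.bal_iff algebra_simps right.target.add right.target.map_mult
      flip: mult.assoc)

lemma coact_add:
  assumes "\<phi> \<in> dual_upper_right s\<^sub>R"
  shows "coact \<phi> (x + y) = coact \<phi> x + coact \<phi> y"
  using additiveD [OF right.sweedler_additive [OF coact_bal(1) [OF assms, of 1]]] by (simp add: coact_def)

lemma coact_sR_left:
  assumes "\<phi> \<in> dual_upper_right s\<^sub>R"
  shows "coact \<phi> (s\<^sub>R r * x) = s\<^sub>R r * coact \<phi> x"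
  using right.sweedler_source_left [OF coact_bal(1) [OF assms, of 1]]
  by (simp add: coact_def mult.assoc sweedler_mult_left)

lemma coact_tL_left:
  assumes "\<phi> \<in> dual_upper_right s\<^sub>R"
  shows "coact \<phi> (t\<^sub>L l * x) = t\<^sub>L l * coact \<phi> x"
  by (metis coact_sR_left [OF assms] sR_piR_tL)

definition twist :: "('a \<Rightarrow> 'r) \<Rightarrow> 'a \<Rightarrow> 'a \<Rightarrow> 'a"
  where "twist \<phi> x h = sweedler (\<lambda>x y. y * t\<^sub>R (\<phi> (S h * x))) (\<gamma>\<^sub>R x)"

lemma twist_add:
  assumes "\<phi> \<in> dual_upper_right s\<^sub>R"
  shows "twist \<phi> x (h + k) = twist \<phi> x h + twist \<phi> x k"
  using assms
  by (simp add: twist_def dual_upper_right_iff antipode.add algebra_simps right.target.add sweedler_add_fun)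

lemma twist_sL_left:
  assumes "\<phi> \<in> dual_upper_right s\<^sub>R"
  shows "twist \<phi> x (s\<^sub>L l * h) = s\<^sub>L l * twist \<phi> x h"
  using right.sweedler_takeuchi [OF coact_bal(2) [OF assms, of 1 "S h"], of "\<pi>\<^sub>R (s\<^sub>L l)" x]
  by (simp add: twist_def antipode_sL_left tR_piR_sL mult.assoc sweedler_mult_left)

text \<open>The right coproduct of S(h) is S(h_2) \<otimes> S(h_1): the leg S(h_2) enters
  \<open>\<phi>\<close> and so forms \<open>twist\<close>, while S(h_1) stays outside.\<close>

lemma coact_antipode_mult:
  assumes \<phi>: "\<phi> \<in> dual_upper_right s\<^sub>R"
  shows "coact \<phi> (S h * x) = sweedler (\<lambda>h k. S h * twist \<phi> x k) (\<gamma>\<^sub>L h)"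
proof -
  have "right.bal (\<lambda>p q. sweedler (\<lambda>x y. q * y * t\<^sub>R (\<phi> (p * x))) (\<gamma>\<^sub>R x))"
    using right.bal_mult [OF coact_bal(1) [OF \<phi>, of 1], of x] by (simp add: mult.assoc)
  from coproduct_antipode [OF this, of h] show ?thesis
    using right.sweedler_mult [OF coact_bal(1) [OF \<phi>, of 1], of "S h" x]
    by (simp add: coact_def twist_def mult.assoc sweedler_mult_left)
qed

text \<open>This solves \<open>coact_antipode_mult\<close> for \<open>twist\<close>: inserting that
  formula and regrouping by mixed coassociativity produces p^1 S(p^2) with p = h_1. This is
  s_L(\<pi>_L(h_1)), which the left counit law absorbs.\<close>

lemma twist_eq:
  assumes \<phi>: "\<phi> \<in> dual_upper_right s\<^sub>R"
  shows "twist \<phi> x h = sweedler (\<lambda>h k. h * coact \<phi> (S k * x)) (\<gamma>\<^sub>R h)"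
proof -
  have add: "additive (twist \<phi> x)"
    by (simp add: additive_def twist_add [OF \<phi>])
  have "sweedler (\<lambda>h k. h * coact \<phi> (S k * x)) (\<gamma>\<^sub>R h) =
      sweedler (\<lambda>h k. sweedler (\<lambda>p q. h * S p * twist \<phi> x q) (\<gamma>\<^sub>L k)) (\<gamma>\<^sub>R h)"
    by (simp add: coact_antipode_mult [OF \<phi>] mult.assoc sweedler_mult_left)
  also have "\<dots> = sweedler (\<lambda>k q. sweedler (\<lambda>h p. h * S p * twist \<phi> x q) (\<gamma>\<^sub>R k)) (\<gamma>\<^sub>L h)"
    by (rule sweedler_coassociative_right_left [symmetric])
      (simp_all add: left.bal_iff right.bal_iff algebra_simps antipode.add antipode_tR_right
        antipode_tL_left twist_add [OF \<phi>] twist_sL_left [OF \<phi>])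
  also have "\<dots> = sweedler (\<lambda>k q. twist \<phi> x (s\<^sub>L (\<pi>\<^sub>L k) * q)) (\<gamma>\<^sub>L h)"
    by (simp add: sweedler_mult_right antipode_coproduct_right twist_sL_left [OF \<phi>])
  also have "\<dots> = twist \<phi> x h"
    by (simp add: additive_sweedler [OF add, symmetric] left.counit_left)
  finally show ?thesis ..
qed

text \<open>\<open>twist_eq\<close> at S(z), with its right coproduct rewritten as S(z_2) \<otimes>
  S(z_1); the square of the antipode in the trace formula originates here.\<close>

lemma twist_antipode:
  assumes \<phi>: "\<phi> \<in> dual_upper_right s\<^sub>R"
  shows "twist \<phi> x (S z) = sweedler (\<lambda>h k. S k * coact \<phi> (S (S h) * x)) (\<gamma>\<^sub>L z)"
proof -
  have "right.bal (\<lambda>h k. h * coact \<phi> (S k * x))"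
    by (simp add: right.bal_iff algebra_simps antipode.add coact_add [OF \<phi>] antipode_tR_right
        coact_sR_left [OF \<phi>])
  then show ?thesis
    by (simp add: twist_eq [OF \<phi>] coproduct_antipode)
qed


section \<open>Integrals\<close>

text \<open>The counterpart of \<open>coact\<close> for functionals in \<open>\<A>\<^sub>*\<close>;
  followed by \<open>\<pi>\<^sub>R\<close> it gives the functionals n_j of the trace
  formula.\<close>

definition lower_coact :: "('a \<Rightarrow> 'l) \<Rightarrow> 'a \<Rightarrow> 'a"
  where "lower_coact f a = sweedler (\<lambda>x y. s\<^sub>L (f x) * y) (\<gamma>\<^sub>L a)"

lemma dual_lower_right_iff:
  "f \<in> dual_lower_right t\<^sub>L \<longleftrightarrow> (\<forall>x y. f (x + y) = f x + f y) \<and> (\<forall>x l. f (t\<^sub>L l * x) = f x * l)"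
  by (simp add: dual_lower_right_def right_hom_def additive_def lower_right_def)

lemma lower_coact_bal:
  assumes "f \<in> dual_lower_right t\<^sub>L"
  shows "left.bal (\<lambda>x y. s\<^sub>L (f x) * y)"
  using assms
  by (simp add: dual_lower_right_iff left.bal_iff algebra_simps left.source.add left.source.map_mult)

lemma lower_coact_add:
  assumes "f \<in> dual_lower_right t\<^sub>L"
  shows "lower_coact f (x + y) = lower_coact f x + lower_coact f y"
  using additiveD [OF left.sweedler_additive [OF lower_coact_bal [OF assms]]] by (simp add: lower_coact_def)

lemma lower_coact_tL_left:
  assumes "f \<in> dual_lower_right t\<^sub>L"
  shows "lower_coact f (t\<^sub>L l * x) = t\<^sub>L l * lower_coact f x"
  by (simp add: lower_coact_def left.sweedler_target_left [OF lower_coact_bal [OF assms]]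
      left.source_target_commute flip: sweedler_mult_left mult.assoc)

lemma lower_coact_sR_left:
  assumes "f \<in> dual_lower_right t\<^sub>L"
  shows "lower_coact f (s\<^sub>R r * x) = s\<^sub>R r * lower_coact f x"
  by (metis lower_coact_tL_left [OF assms] tL_piL_sR)

lemma lower_coact_sR_right:
  assumes "f \<in> dual_lower_right t\<^sub>L"
  shows "lower_coact f (x * s\<^sub>R r) = lower_coact f x * s\<^sub>R r"
  using left.sweedler_target_right [OF lower_coact_bal [OF assms], of x "\<pi>\<^sub>L (s\<^sub>R r)"]
  by (simp add: lower_coact_def tL_piL_sR flip: sweedler_mult_right mult.assoc)

lemma counit_lower_coact:
  assumes "f \<in> dual_lower_right t\<^sub>L"
  shows "(\<lambda>x. \<pi>\<^sub>R (lower_coact f x)) \<in> dual_upper_right s\<^sub>R"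
  by (simp add: dual_upper_right_iff lower_coact_add [OF assms] lower_coact_sR_right [OF assms]
      right.counit_add right.counit_source)

text \<open>Mixed coassociativity leaves \<open>f\<close> on the first leg of the left coproduct and
  splits the second by the right one, whose counit law removes \<open>\<pi>\<^sub>R\<close>. The
  coaction of n_j is thereby known in closed form.\<close>

lemma coact_counit_lower_coact:
  assumes f: "f \<in> dual_lower_right t\<^sub>L"
  shows "coact (\<lambda>x. \<pi>\<^sub>R (lower_coact f x)) a = lower_coact f a"
proof -
  have bal: "right.bal (\<lambda>x y. y * t\<^sub>R (\<pi>\<^sub>R x))"
    by (simp add: right.bal_iff algebra_simps right.counit_add right.target.add right.counit_source
        right.target.map_mult)
  have add: "additive (\<lambda>z. y * t\<^sub>R (\<pi>\<^sub>R z))" for y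
    using bal by (simp add: right.bal_iff additive_def)
  have "coact (\<lambda>x. \<pi>\<^sub>R (lower_coact f x)) a =
      sweedler (\<lambda>x y. sweedler (\<lambda>p q. y * t\<^sub>R (\<pi>\<^sub>R (s\<^sub>L (f p) * q))) (\<gamma>\<^sub>L x)) (\<gamma>\<^sub>R a)"
    by (simp add: coact_def lower_coact_def additive_sweedler [OF add])
  also have "\<dots> = sweedler (\<lambda>p x. sweedler (\<lambda>q y. y * t\<^sub>R (\<pi>\<^sub>R (s\<^sub>L (f p) * q))) (\<gamma>\<^sub>R x)) (\<gamma>\<^sub>L a)"
    by (rule sweedler_coassociative_left_right)
      (use f in \<open>simp_all add: left.bal_iff right.bal_iff algebra_simps right.counit_add right.target.add
        dual_lower_right_iff left.source.add left.source.map_mult right.counit_source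
        right.target.map_mult flip: mult.assoc\<close>)
  also have "\<dots> = sweedler (\<lambda>p x. s\<^sub>L (f p) * x) (\<gamma>\<^sub>L a)"
  proof -
    have "sweedler (\<lambda>q y. y * t\<^sub>R (\<pi>\<^sub>R (s\<^sub>L l * q))) (\<gamma>\<^sub>R x) = s\<^sub>L l * x" for l x
      using right.counit_left [of "t\<^sub>R (\<pi>\<^sub>R (s\<^sub>L l)) * x"] right.sweedler_target_left [OF bal, of "\<pi>\<^sub>R (s\<^sub>L l)" x]
      by (simp add: tR_piR_sL)
    then show ?thesis by simp
  qed
  finally show ?thesis by (simp add: lower_coact_def)
qed

text \<open>A right factor \<open>t\<^sub>R r\<close> is a value of \<open>s\<^sub>L\<close> and
  goes to the first leg of the left coproduct; mixed coassociativity then gathers the whole coaction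
  on that leg.\<close>

lemma coproduct_coact:
  assumes \<phi>: "\<phi> \<in> dual_upper_right s\<^sub>R" and H: "left.bal H"
  shows "sweedler H (\<gamma>\<^sub>L (coact \<phi> a)) = sweedler (\<lambda>x y. H (coact \<phi> x) y) (\<gamma>\<^sub>L a)"
proof -
  have target: "sweedler H (\<gamma>\<^sub>L (y * t\<^sub>R r)) = sweedler (\<lambda>p q. H (p * t\<^sub>R r) q) (\<gamma>\<^sub>L y)" for y r
    using left.sweedler_source_right [OF H, of y "\<pi>\<^sub>L (t\<^sub>R r)"] by (simp add: sL_piL_tR)
  have "sweedler H (\<gamma>\<^sub>L (coact \<phi> a)) =
      sweedler (\<lambda>x y. sweedler (\<lambda>p q. H (p * t\<^sub>R (\<phi> x)) q) (\<gamma>\<^sub>L y)) (\<gamma>\<^sub>R a)"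
    by (simp add: coact_def additive_sweedler [OF left.sweedler_additive [OF H]] target)
  also have "\<dots> = sweedler (\<lambda>x y. sweedler (\<lambda>p q. H (q * t\<^sub>R (\<phi> p)) y) (\<gamma>\<^sub>R x)) (\<gamma>\<^sub>L a)"
    by (rule sweedler_coassociative_right_left [symmetric])
      (use \<phi> H in \<open>simp_all add: left.bal_iff right.bal_iff algebra_simps dual_upper_right_iff
        right.target.add right.target.map_mult\<close>)
  also have "\<dots> = sweedler (\<lambda>x y. H (coact \<phi> x) y) (\<gamma>\<^sub>L a)"
    by (simp add: coact_def additive_sweedler [OF balanced2_additive(1) [OF H]])
  finally show ?thesis .
qed

lemma sweedler_antipode_lower_coact:
  assumes f: "f \<in> dual_lower_right t\<^sub>L"
  shows "sweedler (\<lambda>x y. S (lower_coact f x) * y) (\<gamma>\<^sub>L a) = s\<^sub>R (\<pi>\<^sub>R (lower_coact f a))"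
proof -
  have add: "additive (\<lambda>z. S z * y)" for y
    by (simp add: additive_def antipode.add distrib_right)
  have add': "additive (\<lambda>z. s\<^sub>R (\<pi>\<^sub>R z))"
    by (simp add: additive_def right.counit_add right.source.add)
  have "sweedler (\<lambda>x y. S (lower_coact f x) * y) (\<gamma>\<^sub>L a) =
      sweedler (\<lambda>x y. sweedler (\<lambda>p q. S (s\<^sub>L (f p) * q) * y) (\<gamma>\<^sub>L x)) (\<gamma>\<^sub>L a)"
    by (simp add: lower_coact_def additive_sweedler [OF add])
  also have "\<dots> = sweedler (\<lambda>p x. sweedler (\<lambda>q y. S (s\<^sub>L (f p) * q) * y) (\<gamma>\<^sub>L x)) (\<gamma>\<^sub>L a)"
  proof (rule sweedler_coassociative_left_left)
    show "left.bal (\<lambda>q y. S (s\<^sub>L (f p) * q) * y)" for p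
      by (rule left.bal_source_left [OF bal_antipode_left])
    show "left.bal (\<lambda>p q. S (s\<^sub>L (f p) * q) * y)" for y
      using f by (simp add: left.bal_iff algebra_simps dual_lower_right_iff antipode.add left.source.add
          left.source.map_mult)
  qed
  also have "\<dots> = sweedler (\<lambda>p x. s\<^sub>R (\<pi>\<^sub>R (s\<^sub>L (f p) * x))) (\<gamma>\<^sub>L a)"
    by (simp add: antipode_coproduct_left flip: left.sweedler_source_left [OF bal_antipode_left])
  also have "\<dots> = s\<^sub>R (\<pi>\<^sub>R (lower_coact f a))"
    by (simp add: lower_coact_def additive_sweedler [OF add'])
  finally show ?thesis .
qed

section \<open>Left integrals as traces over a dual basis\<close>

context
  fixes J :: "'a set" and f :: "'a \<Rightarrow> 'a \<Rightarrow> 'l" and b :: "'a \<Rightarrow> 'a"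
  assumes f: "\<And>j. f j \<in> dual_lower_right t\<^sub>L"
    and expand: "\<And>a. a = (\<Sum>j\<in>J. t\<^sub>L (f j a) * b j)"
begin

definition trace_integral :: "('a \<Rightarrow> 'r) \<Rightarrow> 'a \<Rightarrow> 'r"
  where "trace_integral \<phi> x = (\<Sum>j\<in>J. \<pi>\<^sub>R (lower_coact (f j) (S (S (coact \<phi> (b j))) * x)))"

text \<open>The coaction of the trace is a double sum over the dual basis. As with cyclicity of a
  trace, exchanging the indices lets one of them be summed away, and the antipode identity contracts
  the rest.\<close>

lemma trace_integral:
  assumes \<phi>: "\<phi> \<in> dual_upper_right s\<^sub>R"
  shows "trace_integral \<phi> \<in> left_integrals_upper_right s\<^sub>R t\<^sub>R \<gamma>\<^sub>R"
proof -
  let ?n = "\<lambda>j x. \<pi>\<^sub>R (lower_coact (f j) x)"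
  have n: "?n j \<in> dual_upper_right s\<^sub>R" for j
    by (rule counit_lower_coact [OF f])
  have dual: "trace_integral \<phi> \<in> dual_upper_right s\<^sub>R"
    using n by (simp add: dual_upper_right_iff trace_integral_def distrib_left sum.distrib sum_distrib_right
        flip: mult.assoc)
  have "sweedler (\<lambda>x y. y * t\<^sub>R (trace_integral \<phi> x)) (\<gamma>\<^sub>R a) = s\<^sub>R (trace_integral \<phi> a)" for a
  proof -
    \<comment> \<open>The argument of n_j with the basis element left free. Applying
      \<open>S\<close> twice turns a left factor \<open>t\<^sub>L l\<close> of \<open>p\<close> into
      one in the range of \<open>s\<^sub>R\<close>, which \<open>lower_coact\<close> lets
      through.\<close>
    define u where "u p = S (S (coact \<phi> p)) * a" for p
    have u_add: "u (p + q) = u p + u q" for p q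
      by (simp add: u_def coact_add [OF \<phi>] antipode.add distrib_right)
    have u_tL: "u (t\<^sub>L l * p) = s\<^sub>R (\<pi>\<^sub>R (s\<^sub>L l)) * u p" for l p
      by (simp add: u_def coact_tL_left [OF \<phi>] antipode_tL_left antipode_sL_right mult.assoc)
    have u_sum: "u (\<Sum>j\<in>I. g j) = (\<Sum>j\<in>I. u (g j))" for g :: "'a \<Rightarrow> 'a" and I
      by (rule additive.sum) (simp add: additive_def u_add)
    have addS: "additive S"
      by (simp add: additive_def antipode.add)
    let ?q = "\<lambda>j. lower_coact (f j)"
    have "sweedler (\<lambda>x y. y * t\<^sub>R (trace_integral \<phi> x)) (\<gamma>\<^sub>R a) = (\<Sum>j\<in>J. twist (?n j) a (S (coact \<phi> (b j))))"
      by (simp add: trace_integral_def twist_def right.target.sum sum_distrib_left sweedler_sum_fun)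
    also have "\<dots> = (\<Sum>j\<in>J. sweedler (\<lambda>h k. S k * ?q j (S (S h) * a)) (\<gamma>\<^sub>L (coact \<phi> (b j))))"
      by (simp add: twist_antipode [OF n] coact_counit_lower_coact [OF f])
    also have "\<dots> = (\<Sum>j\<in>J. sweedler (\<lambda>p q. S q * ?q j (u p)) (\<gamma>\<^sub>L (b j)))"
    proof -
      have "left.bal (\<lambda>h k. S k * ?q j (S (S h) * a))" for j
        by (simp add: left.bal_iff algebra_simps antipode.add lower_coact_add [OF f] antipode_tL_left
            antipode_sL_right antipode_sL_left lower_coact_sR_left [OF f])
      then show ?thesis
        by (simp add: coproduct_coact [OF \<phi>] u_def)
    qed
    \<comment> \<open>The leg \<open>p\<close> is expanded in the dual basis. Its coefficients pass
      through \<open>u\<close> and \<open>?q j\<close> and are absorbed into \<open>S\<close> as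
      \<open>s\<^sub>L (f k p)\<close>, so that summing over the coproduct yields
      \<open>S (?q k (b j))\<close>.\<close>
    also have "\<dots> = (\<Sum>j\<in>J. \<Sum>k\<in>J. S (?q k (b j)) * ?q j (u (b k)))"
    proof -
      have "S q * ?q j (u p) = (\<Sum>k\<in>J. S (s\<^sub>L (f k p) * q) * ?q j (u (b k)))" for p q j
      proof -
        have "S q * ?q j (u p) = S q * ?q j (\<Sum>k\<in>J. s\<^sub>R (\<pi>\<^sub>R (s\<^sub>L (f k p))) * u (b k))"
          using arg_cong [OF expand [of p], of u] by (simp add: u_sum u_tL)
        also have "?q j (\<Sum>k\<in>J. s\<^sub>R (\<pi>\<^sub>R (s\<^sub>L (f k p))) * u (b k)) =
            (\<Sum>k\<in>J. s\<^sub>R (\<pi>\<^sub>R (s\<^sub>L (f k p))) * ?q j (u (b k)))"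
          by (subst additive.sum [of "?q j"]) (simp_all add: additive_def lower_coact_add [OF f] lower_coact_sR_left [OF f])
        finally show ?thesis
          by (simp add: sum_distrib_left antipode_sL_left mult.assoc)
      qed
      then have "sweedler (\<lambda>p q. S q * ?q j (u p)) (\<gamma>\<^sub>L c) =
          sweedler (\<lambda>p q. \<Sum>k\<in>J. S (s\<^sub>L (f k p) * q) * ?q j (u (b k))) (\<gamma>\<^sub>L c)" for j c
        by (intro arg_cong [where f = "\<lambda>g. sweedler g (\<gamma>\<^sub>L c)"] ext)
      then show ?thesis
        by (simp add: sweedler_sum_fun sweedler_mult_right lower_coact_def additive_sweedler [OF addS])
    qed
    \<comment> \<open>After the exchange, the sum over \<open>j\<close> expands the first leg of the
      coproduct of \<open>u (b k)\<close> and can be undone.\<close>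
    also have "\<dots> = (\<Sum>k\<in>J. \<Sum>j\<in>J. S (?q k (b j)) * ?q j (u (b k)))"
      by (rule sum.swap)
    also have "\<dots> = (\<Sum>k\<in>J. sweedler (\<lambda>v w. S (?q k v) * w) (\<gamma>\<^sub>L (u (b k))))"
    proof -
      have "(\<Sum>j\<in>J. S (?q k (b j)) * ?q j c) = sweedler (\<lambda>v w. S (?q k v) * w) (\<gamma>\<^sub>L c)" for k c
      proof -
        have S_expand: "S (?q k v) = (\<Sum>j\<in>J. S (?q k (b j)) * s\<^sub>L (f j v))" for v
        proof -
          have "additive (\<lambda>z. S (?q k z))"
            by (simp add: additive_def lower_coact_add [OF f] antipode.add)
          from additive.sum [OF this, of "\<lambda>j. t\<^sub>L (f j v) * b j" J] show ?thesis
            by (simp add: expand [symmetric] lower_coact_tL_left [OF f] antipode_tL_left)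
        qed
        have "S (?q k v) * w = (\<Sum>j\<in>J. S (?q k (b j)) * (s\<^sub>L (f j v) * w))" for v w
          using S_expand [of v] by (simp add: sum_distrib_right mult.assoc)
        then have "sweedler (\<lambda>v w. S (?q k v) * w) (\<gamma>\<^sub>L c) =
            sweedler (\<lambda>v w. \<Sum>j\<in>J. S (?q k (b j)) * (s\<^sub>L (f j v) * w)) (\<gamma>\<^sub>L c)"
          by (intro arg_cong [where f = "\<lambda>g. sweedler g (\<gamma>\<^sub>L c)"] ext)
        then show ?thesis
          by (simp add: sweedler_sum_fun sweedler_mult_left lower_coact_def)
      qed
      then show ?thesis by simp
    qed
    also have "\<dots> = s\<^sub>R (trace_integral \<phi> a)"
      by (simp add: sweedler_antipode_lower_coact [OF f] trace_integral_def u_def right.source.sum)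
    finally show ?thesis .
  qed
  with dual show ?thesis
    by (simp add: left_integrals_upper_right_def)
qed

text \<open>Since \<open>S\<close> reverses products, \<open>S (S y) * S (c i)\<close> is
  \<open>S (c i * S y)\<close>, and the sum over \<open>i\<close> collapses to
  \<open>S (s\<^sub>L (\<pi>\<^sub>L (b j)))\<close>. The sum over \<open>j\<close> then amounts to
  the counit of the expansion of \<open>1\<close>.\<close>

lemma sum_trace_integral:
  assumes \<xi>: "\<And>i. \<xi> i \<in> dual_upper_right s\<^sub>R" and x: "\<And>a. a = (\<Sum>i\<in>I. c i * s\<^sub>R (\<xi> i a))"
  shows "(\<Sum>i\<in>I. trace_integral (\<xi> i) (S (c i))) = 1"
proof -
  let ?q = "\<lambda>j. lower_coact (f j)"
  have add_q: "additive (\<lambda>z. \<pi>\<^sub>R (?q j (S z)))" for j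
    by (simp add: additive_def lower_coact_add [OF f] antipode.add right.counit_add)
  have addS: "additive S"
    by (simp add: additive_def antipode.add)
  \<comment> \<open>Under \<open>S\<close> the factor \<open>t\<^sub>R (\<xi> i p)\<close> comes to
    the front as \<open>s\<^sub>R (\<xi> i p)\<close> and completes the expansion of the first leg
    \<open>p\<close>, leaving y^1 S(y^2).\<close>
  have *: "(\<Sum>i\<in>I. c i * S (coact (\<xi> i) y)) = s\<^sub>L (\<pi>\<^sub>L y)" for y
  proof -
    have "(\<Sum>i\<in>I. c i * S (coact (\<xi> i) y)) = sweedler (\<lambda>p q. (\<Sum>i\<in>I. c i * s\<^sub>R (\<xi> i p)) * S q) (\<gamma>\<^sub>R y)"
      by (simp add: coact_def additive_sweedler [OF addS] antipode_tR_right sum_distrib_right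
          sweedler_sum_fun sweedler_mult_left mult.assoc)
    then show ?thesis
      by (simp add: x [symmetric] antipode_coproduct_right)
  qed
  have "(\<Sum>i\<in>I. trace_integral (\<xi> i) (S (c i))) = (\<Sum>j\<in>J. \<Sum>i\<in>I. \<pi>\<^sub>R (?q j (S (c i * S (coact (\<xi> i) (b j))))))"
    unfolding trace_integral_def by (subst sum.swap) (simp add: antipode_mult)
  also have "\<dots> = (\<Sum>j\<in>J. \<pi>\<^sub>R (?q j (S (s\<^sub>L (\<pi>\<^sub>L (b j))))))"
    by (simp add: additive.sum [OF add_q, symmetric] *)
  also have "\<dots> = (\<Sum>j\<in>J. \<pi>\<^sub>R (s\<^sub>L (\<pi>\<^sub>L (b j)) * s\<^sub>L (f j 1)))"
  proof -
    have "?q j (S (s\<^sub>L l)) = s\<^sub>R (\<pi>\<^sub>R (s\<^sub>L l)) * s\<^sub>L (f j 1)" for j l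
      using antipode_sL_right [of 1 l] lower_coact_sR_left [OF f, of j "\<pi>\<^sub>R (s\<^sub>L l)" 1]
      by (simp add: antipode_one lower_coact_def left.sweedler_one [OF lower_coact_bal [OF f]])
    then show ?thesis
      by (simp add: right.counit_mult_source)
  qed
  also have "\<dots> = \<pi>\<^sub>R (s\<^sub>L (\<Sum>j\<in>J. \<pi>\<^sub>L (t\<^sub>L (f j 1) * b j)))"
  proof -
    have "additive \<pi>\<^sub>R" by (simp add: additive_def right.counit_add)
    then show ?thesis
      by (simp add: left.counit_target left.source.map_mult left.source.sum additive.sum)
  qed
  also have "(\<Sum>j\<in>J. \<pi>\<^sub>L (t\<^sub>L (f j 1) * b j)) = 1"
  proof -
    have "additive \<pi>\<^sub>L" by (simp add: additive_def left.counit_add)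
    then show ?thesis
      using additive.sum [of \<pi>\<^sub>L "\<lambda>j. t\<^sub>L (f j 1) * b j" J]
      by (simp add: expand [of 1, symmetric] left.counit_one)
  qed
  finally show ?thesis
    by (simp add: left.source.map_one right.counit_one)
qed

end

section \<open>Transfer of left integrals to the other duals\<close>

lemma left_integral_antipode:
  assumes "\<phi> \<in> left_integrals_upper_right s\<^sub>R t\<^sub>R \<gamma>\<^sub>R"
  shows "\<phi> \<circ> S \<in> left_integrals_upper_left s\<^sub>R t\<^sub>R \<gamma>\<^sub>R"
proof -
  have \<phi>: "\<phi> \<in> dual_upper_right s\<^sub>R" and int: "coact \<phi> a = s\<^sub>R (\<phi> a)" for a
    using assms by (auto simp: left_integrals_upper_right_def coact_def)
  \<comment> \<open>The coaction commutes with left factors from \<open>s\<^sub>R\<close>. For an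
    integral it is \<open>s\<^sub>R (\<phi> a)\<close>, so injectivity makes \<open>\<phi>\<close>
    linear on the left as well.\<close>
  have "inj s\<^sub>R"
    by (rule inj_on_inverseI [of _ "\<lambda>x. \<pi>\<^sub>R x"])
      (metis mult_1_left right.counit_one right.counit_source)
  then have "\<phi> (s\<^sub>R r * a) = r * \<phi> a" for r a
    using coact_sR_left [OF \<phi>, of r a] by (simp add: int inj_eq flip: right.source.map_mult)
  then have dual: "\<phi> \<circ> S \<in> dual_upper_left t\<^sub>R"
    using \<phi> by (simp add: dual_upper_right_iff dual_upper_left_def left_hom_def additive_def
        upper_left_def antipode.add antipode_tR_right)
  \<comment> \<open>As the right coproduct of 1 is 1 \<otimes> 1, \<open>twist_eq\<close> at x = 1
    becomes the integral equation for \<open>\<phi> \<circ> S\<close>.\<close>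
  have "twist \<phi> 1 a = t\<^sub>R (\<phi> (S a))" for a
    using right.sweedler_one [OF coact_bal(2) [OF \<phi>, of 1 "S a"]] by (simp add: twist_def)
  with twist_eq [OF \<phi>, of 1] dual show ?thesis
    by (simp add: left_integrals_upper_left_def int)
qed

text \<open>For an integral, \<open>coact \<phi> a\<close> is a value of \<open>s\<^sub>R\<close>,
  hence fixed by t_L \<pi>_L. The required equation is the left counit law for it, its coproduct
  being given by \<open>coproduct_coact\<close>.\<close>

lemma right_integral_lower_right:
  assumes "\<phi> \<in> left_integrals_upper_right s\<^sub>R t\<^sub>R \<gamma>\<^sub>R"
  shows "(\<lambda>a. \<pi>\<^sub>L (s\<^sub>R (\<phi> a))) \<in> right_integrals_lower_right s\<^sub>L t\<^sub>L \<gamma>\<^sub>L"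
proof -
  have \<phi>: "\<phi> \<in> dual_upper_right s\<^sub>R" and int: "s\<^sub>R (\<phi> a) = coact \<phi> a" for a
    using assms by (auto simp: left_integrals_upper_right_def coact_def)
  have bal: "left.bal (\<lambda>x y. s\<^sub>L (\<pi>\<^sub>L x) * y)"
    by (simp add: left.bal_iff algebra_simps left.counit_add left.source.add left.counit_target
        left.source.map_mult)
  have "sweedler (\<lambda>x y. s\<^sub>L (\<pi>\<^sub>L (coact \<phi> x)) * y) (\<gamma>\<^sub>L a) = coact \<phi> a" for a
    using coproduct_coact [OF \<phi> bal, of a] by (simp add: left.counit_left)
  moreover have "t\<^sub>L (\<pi>\<^sub>L (coact \<phi> a)) = coact \<phi> a" for a
    by (metis int tL_piL_sR)
  moreover have "(\<lambda>a. \<pi>\<^sub>L (coact \<phi> a)) \<in> dual_lower_right t\<^sub>L"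
    by (simp add: dual_lower_right_iff coact_add [OF \<phi>] left.counit_add coact_tL_left [OF \<phi>] left.counit_target)
  ultimately show ?thesis
    by (simp add: right_integrals_lower_right_def int)
qed

text \<open>The integral equation replaces \<open>t\<^sub>R (\<phi> y)\<close> by y^1
  s_R(\<phi>(y^2)); mixed coassociativity regroups, and the left counit law contracts.\<close>

lemma right_integral_lower_left:
  assumes "\<phi> \<in> left_integrals_upper_left s\<^sub>R t\<^sub>R \<gamma>\<^sub>R"
  shows "(\<lambda>a. \<pi>\<^sub>L (t\<^sub>R (\<phi> a))) \<in> right_integrals_lower_left s\<^sub>L t\<^sub>L \<gamma>\<^sub>L"
proof -
  have \<phi>: "\<phi> (x + y) = \<phi> x + \<phi> y" "\<phi> (x * t\<^sub>R r) = r * \<phi> x"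
    and int: "t\<^sub>R (\<phi> a) = sweedler (\<lambda>x y. x * s\<^sub>R (\<phi> y)) (\<gamma>\<^sub>R a)" for a x y r
    using assms by (auto simp: left_integrals_upper_left_def dual_upper_left_def left_hom_def
        additive_def upper_left_def)
  have bal: "right.bal (\<lambda>x y. x * s\<^sub>R (\<phi> y))"
    by (simp add: right.bal_iff algebra_simps \<phi> right.source.add right.source.map_mult)
  \<comment> \<open>The integral equation also yields linearity over \<open>s\<^sub>L\<close>, whose
    values are values of \<open>t\<^sub>R\<close>.\<close>
  have tR_left: "t\<^sub>R (\<phi> (t\<^sub>R r * a)) = t\<^sub>R r * t\<^sub>R (\<phi> a)" for r a
    using right.sweedler_target_left [OF bal, of r a] by (simp add: int mult.assoc sweedler_mult_left)
  have "t\<^sub>R (\<phi> (s\<^sub>L l * a)) = s\<^sub>L l * t\<^sub>R (\<phi> a)" for l a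
    using tR_left [of "\<pi>\<^sub>R (s\<^sub>L l)" a] by (simp add: tR_piR_sL)
  then have dual: "(\<lambda>a. \<pi>\<^sub>L (t\<^sub>R (\<phi> a))) \<in> dual_lower_left s\<^sub>L"
    by (simp add: dual_lower_left_def left_hom_def additive_def lower_left_def \<phi> right.target.add
        left.counit_add left.counit_source)
  have bal': "left.bal (\<lambda>x y. t\<^sub>L (\<pi>\<^sub>L y) * x)"
    by (simp add: left.bal_iff algebra_simps left.counit_add left.target.add left.counit_source
        left.target.map_mult)
  have add: "additive (\<lambda>z. t\<^sub>L (\<pi>\<^sub>L z) * x)" for x
    using bal' by (simp add: left.bal_iff additive_def)
  have sR_right: "sweedler (\<lambda>x y. t\<^sub>L (\<pi>\<^sub>L (y * s\<^sub>R r)) * x) (\<gamma>\<^sub>L a) = a * s\<^sub>R r" for r a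
    using left.counit_right [of "a * s\<^sub>R r"] left.sweedler_target_right [OF bal', of a "\<pi>\<^sub>L (s\<^sub>R r)"]
    by (simp add: tL_piL_sR)
  have "sweedler (\<lambda>x y. t\<^sub>L (\<pi>\<^sub>L (t\<^sub>R (\<phi> y))) * x) (\<gamma>\<^sub>L a) = t\<^sub>R (\<phi> a)" for a
  proof -
    have "sweedler (\<lambda>x y. t\<^sub>L (\<pi>\<^sub>L (t\<^sub>R (\<phi> y))) * x) (\<gamma>\<^sub>L a) =
        sweedler (\<lambda>x y. sweedler (\<lambda>p q. t\<^sub>L (\<pi>\<^sub>L (p * s\<^sub>R (\<phi> q))) * x) (\<gamma>\<^sub>R y)) (\<gamma>\<^sub>L a)"
      by (simp add: int additive_sweedler [OF add])
    also have "\<dots> = sweedler (\<lambda>y q. sweedler (\<lambda>x p. t\<^sub>L (\<pi>\<^sub>L (p * s\<^sub>R (\<phi> q))) * x) (\<gamma>\<^sub>L y)) (\<gamma>\<^sub>R a)"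
      by (rule sweedler_coassociative_left_right [symmetric])
        (simp_all add: left.bal_iff right.bal_iff algebra_simps left.counit_add left.target.add
          left.counit_source left.target.map_mult \<phi> right.source.add right.source.map_mult)
    finally show ?thesis
      by (simp add: sR_right int)
  qed
  with dual show ?thesis
    by (simp add: right_integrals_lower_left_def sL_piL_tR)
qed

text \<open>The values in \<open>sum_trace_integral\<close> add up to \<open>1\<close>, which is
  nonzero in \<open>'r\<close>, so some term is nonzero. A value at \<open>S a\<close> is recorded
  because \<open>\<phi> \<circ> S\<close> must be nonzero too.\<close>

lemma exists_left_integral_antipode_nonzero:
  assumes "right_finitely_generated (upper_right s\<^sub>R)" "right_projective (upper_right s\<^sub>R)"
    and "right_finitely_generated (lower_right t\<^sub>L)" "right_projective (lower_right t\<^sub>L)"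
  obtains \<phi> a where "\<phi> \<in> left_integrals_upper_right s\<^sub>R t\<^sub>R \<gamma>\<^sub>R" "\<phi> (S a) \<noteq> 0"
proof -
  show thesis
  proof (rule right_dual_basis [OF assms(1,2)], rule right_dual_basis [OF assms(3,4)])
    fix I J :: "'a set" and \<xi> :: "'a \<Rightarrow> 'a \<Rightarrow> 'r" and f :: "'a \<Rightarrow> 'a \<Rightarrow> 'l" and c b :: "'a \<Rightarrow> 'a"
    assume "\<And>i. right_hom (upper_right s\<^sub>R) (*) (\<xi> i)" "\<And>j. right_hom (lower_right t\<^sub>L) (*) (f j)"
    then have \<xi>: "\<And>i. \<xi> i \<in> dual_upper_right s\<^sub>R" and f: "\<And>j. f j \<in> dual_lower_right t\<^sub>L"
      by (simp_all add: dual_upper_right_def dual_lower_right_def)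
    assume "\<And>a. a = (\<Sum>i\<in>I. upper_right s\<^sub>R (c i) (\<xi> i a))"
    then have x: "\<And>a. a = (\<Sum>i\<in>I. c i * s\<^sub>R (\<xi> i a))"
      unfolding upper_right_def .
    assume "\<And>a. a = (\<Sum>j\<in>J. lower_right t\<^sub>L (b j) (f j a))"
    then have b: "\<And>a. a = (\<Sum>j\<in>J. t\<^sub>L (f j a) * b j)"
      unfolding lower_right_def .
    have "(\<Sum>i\<in>I. trace_integral J f b (\<xi> i) (S (c i))) \<noteq> 0"
      by (simp add: sum_trace_integral [OF f b \<xi> x])
    then obtain i where "trace_integral J f b (\<xi> i) (S (c i)) \<noteq> 0"
      by (rule sum.not_neutral_contains_not_neutral)
    with trace_integral [OF f b \<xi>] show thesis
      by (rule that)
  qed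
qed

end

theorem corollary4p5:
  fixes scaleA :: "'k::comm_ring_1 \<Rightarrow> 'a::ring_1 \<Rightarrow> 'a"
    and scaleL :: "'k \<Rightarrow> 'l::ring_1 \<Rightarrow> 'l"
    and scaleR :: "'k \<Rightarrow> 'r::ring_1 \<Rightarrow> 'r"
    and s\<^sub>L t\<^sub>L :: "'l \<Rightarrow> 'a"
    and \<gamma>\<^sub>L :: "'a \<Rightarrow> ('a \<times> 'a \<Rightarrow>\<^sub>0 int) set"
    and \<pi>\<^sub>L :: "'a \<Rightarrow> 'l"
    and s\<^sub>R t\<^sub>R :: "'r \<Rightarrow> 'a"
    and \<gamma>\<^sub>R :: "'a \<Rightarrow> ('a \<times> 'a \<Rightarrow>\<^sub>0 int) set"
    and \<pi>\<^sub>R :: "'a \<Rightarrow> 'r"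
    and S :: "'a \<Rightarrow> 'a"
  assumes "hopf_algebroid scaleA scaleL scaleR s\<^sub>L t\<^sub>L \<gamma>\<^sub>L \<pi>\<^sub>L s\<^sub>R t\<^sub>R \<gamma>\<^sub>R \<pi>\<^sub>R S"
    and "right_finitely_generated (upper_right s\<^sub>R)" and "right_projective (upper_right s\<^sub>R)"
    and "left_finitely_generated (upper_left t\<^sub>R)" and "left_projective (upper_left t\<^sub>R)"
    and "left_finitely_generated (lower_left s\<^sub>L)" and "left_projective (lower_left s\<^sub>L)"
    and "right_finitely_generated (lower_right t\<^sub>L)" and "right_projective (lower_right t\<^sub>L)"
  shows "(\<exists>\<phi> \<in> left_integrals_upper_right s\<^sub>R t\<^sub>R \<gamma>\<^sub>R. \<phi> \<noteq> (\<lambda>_. 0)) \<and>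
    (\<exists>\<phi> \<in> left_integrals_upper_left s\<^sub>R t\<^sub>R \<gamma>\<^sub>R. \<phi> \<noteq> (\<lambda>_. 0)) \<and>
    (\<exists>\<rho> \<in> right_integrals_lower_left s\<^sub>L t\<^sub>L \<gamma>\<^sub>L. \<rho> \<noteq> (\<lambda>_. 0)) \<and>
    (\<exists>\<rho> \<in> right_integrals_lower_right s\<^sub>L t\<^sub>L \<gamma>\<^sub>L. \<rho> \<noteq> (\<lambda>_. 0))"
proof -
  interpret hopf_algebroid scaleA scaleL scaleR s\<^sub>L t\<^sub>L \<gamma>\<^sub>L \<pi>\<^sub>L s\<^sub>R t\<^sub>R \<gamma>\<^sub>R \<pi>\<^sub>R S
    by fact
  obtain \<phi> a where \<phi>: "\<phi> \<in> left_integrals_upper_right s\<^sub>R t\<^sub>R \<gamma>\<^sub>R" and nonzero: "\<phi> (S a) \<noteq> 0"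
    using exists_left_integral_antipode_nonzero assms(2,3,8,9) by blast
  have sR: "\<pi>\<^sub>R (s\<^sub>R r) = r" and tR: "\<pi>\<^sub>R (t\<^sub>R r) = r" for r
    using right.counit_source [of 1 r] right.counit_target [of 1 r] by (simp_all add: right.counit_one)
  \<comment> \<open>Here \<open>t\<^sub>L\<close> or \<open>s\<^sub>L\<close> recovers
    \<open>s\<^sub>R r\<close> or \<open>t\<^sub>R r\<close>, and \<open>\<pi>\<^sub>R\<close> then
    recovers \<open>r\<close>.\<close>
  have "\<pi>\<^sub>L (s\<^sub>R r) = 0 \<Longrightarrow> r = 0" "\<pi>\<^sub>L (t\<^sub>R r) = 0 \<Longrightarrow> r = 0" for r
    by (metis tL_piL_sR left.target.zero sR right.source.zero,
        metis sL_piL_tR left.source.zero tR right.target.zero)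
  with nonzero have "\<phi> \<noteq> (\<lambda>_. 0)" "\<phi> \<circ> S \<noteq> (\<lambda>_. 0)"
    "(\<lambda>a. \<pi>\<^sub>L (t\<^sub>R ((\<phi> \<circ> S) a))) \<noteq> (\<lambda>_. 0)" "(\<lambda>a. \<pi>\<^sub>L (s\<^sub>R (\<phi> a))) \<noteq> (\<lambda>_. 0)"
    by (auto simp: fun_eq_iff)
  with \<phi> left_integral_antipode [OF \<phi>] right_integral_lower_left [OF left_integral_antipode [OF \<phi>]]
    right_integral_lower_right [OF \<phi>]
  show ?thesis by blast
qed

end
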